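(* There exists an analytic function $f\in H^\infty(\mathbb{T}^\infty)$, without zeros (that is, $f(z)\ne0$ for all $z\in\mathbb{D}^\infty\cap c_0$), that fails to have an unrestricted radial limit at almost every boundary point $e^{i\theta}\in\mathbb{T}^\infty$. In fact, $f$ has the following properties: (i) For almost every point $e^{i\theta}\in\mathbb{T}^\infty$ there is a radial approach $(r_{n,k})$ (depending on $e^{i\theta}$) that is coordinatewise increasing, in the sense that $r_{n,k}\nearrow1^-$ as $k\to\infty$ for each $n\ge1$, but under which $f$ fails to converge to the right value $f(e^{i\theta})$. Actually, in this boundary approach one has $$\lim_{k\to\infty}|f(r_{1,k}e^{i\theta_1},r_{2,k}e^{i\theta_2},\ldots)|=0\quad\text{for a.e. } e^{i\theta}\in\mathbb{T}^\infty.$$ (ii) There is a radial approach $(r_{n,k})$ that is independent of the boundary point, but under which $f$ fails to converge to the right value at almost every boundary point; that is, for almost every $e^{i\theta}\in\mathbb{T}^\infty$ it is not the case that $f(r_{1,k}e^{i\theta_1},r_{2,k}e^{i\theta_2},\ldots)\to f(e^{i\theta})$ as $k\to\infty$.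
   Context: $\mathbb{T}$ is the unit circle, $\mathbb{D}$ the open unit disc, and $\mathbb{T}^\infty=\{(z_1,z_2,\ldots):z_n\in\mathbb{T}\}$ is the compact abelian group (product topology) with normalized Haar measure $d\theta$; "almost every" refers to $d\theta$. $\mathbb{D}^\infty=\{(z_1,z_2,\ldots):z_n\in\mathbb{D}\}$, and $c_0$ is the space of complex sequences tending to $0$. $\mathbb{N}^\infty_0$ is the set of sequences of nonnegative integers with finitely many non-zero entries. $H^\infty(\mathbb{T}^\infty)$ is the space of $f\in L^\infty(\mathbb{T}^\infty)$ whose Fourier coefficients $\widehat f(\nu)$, $\nu$ a finitely supported integer sequence, vanish for $\nu\notin\mathbb{N}^\infty_0$. Every $f\in H^\infty(\mathbb{T}^\infty)$ has well-defined point evaluations at $z\in\mathbb{D}^\infty\cap c_0$, given by $f(z)=\lim_{m\to\infty}A_mf(z_1,\ldots,z_m)$, where $A_mf(z_1,\ldots,z_m)=\sum_{\nu\in\mathbb{N}^m}\widehat f(\nu_1,\ldots,\nu_m,0,0,\ldots)z_1^{\nu_1}\cdots z_m^{\nu_m}$ (with $0\in\mathbb{N}$); $f(e^{i\theta})$ denotes the (a.e. defined) boundary value, i.e. the $L^\infty$ function itself. A radial approach is a family of radii $r_{n,k}\in[0,1)$, $n,k\ge1$, such that $(r_{n,k})_{n\ge1}\in c_0$ for each $k$ and $\lim_{k\to\infty}r_{n,k}=1$ for each $n$; it approaches $e^{i\theta}$ through the points $(r_{1,k}e^{i\theta_1},r_{2,k}e^{i\theta_2},\ldots)$. The notation $r_{n,k}\nearrow1^-$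 means nondecreasing in $k$ with limit $1$. $f$ has an unrestricted radial limit at $e^{i\theta}$ if there is $L\in\mathbb{C}$ such that $f(r_{1,k}e^{i\theta_1},r_{2,k}e^{i\theta_2},\ldots)\to L$ as $k\to\infty$ for every radial approach. *)

theory Defs
  imports "HOL-Probability.Probability"
begin

text \<open>
  Coordinates of \<open>\<T>\<^sup>\<infinity>\<close> and the approach parameter \<open>k\<close> are indexed by \<^typ>\<open>nat\<close>, starting from 0.
  The normalized Haar measure of \<open>\<T>\<^sup>\<infinity>\<close> is the product of the normalized arc length measures;
  its Borel sets form the product sigma-algebra because \<open>\<T>\<close> is second countable.
\<close>

definition circle_measure :: "complex measure" where
  "circle_measure =
     distr (uniform_measure lborel {0..2 * pi}) (restrict_space borel (sphere 0 1)) cis"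

definition torus :: "(nat \<Rightarrow> complex) measure" where
  "torus = PiM UNIV (\<lambda>_. circle_measure)"

definition fourier_coeff :: "((nat \<Rightarrow> complex) \<Rightarrow> complex) \<Rightarrow> (nat \<Rightarrow> int) \<Rightarrow> complex" where
  "fourier_coeff f \<nu> = (LINT z|torus. f z * cnj (\<Prod>n | \<nu> n \<noteq> 0. z n powi \<nu> n))"

text \<open>Elements of \<open>L\<^sup>\<infinity>(\<T>\<^sup>\<infinity>)\<close> are given by representatives; the predicates below depend on
  them only up to almost everywhere equality.\<close>

definition Linf_torus :: "((nat \<Rightarrow> complex) \<Rightarrow> complex) set" where
  "Linf_torus = {f \<in> borel_measurable torus. \<exists>C. AE z in torus. norm (f z) \<le> C}"

definition Hinf_torus :: "((nat \<Rightarrow> complex) \<Rightarrow> complex) set" where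
  "Hinf_torus = {f \<in> Linf_torus. \<forall>\<nu>. finite {n. \<nu> n \<noteq> 0} \<longrightarrow> \<not> (\<forall>n. 0 \<le> \<nu> n)
                   \<longrightarrow> fourier_coeff f \<nu> = 0}"

definition polydisc_c0 :: "(nat \<Rightarrow> complex) set" where
  "polydisc_c0 = {z. (\<forall>n. norm (z n) < 1) \<and> z \<longlonglongrightarrow> 0}"

text \<open>\<open>\<nat>\<^sup>m\<close> is identified with the sequences of naturals vanishing from index \<open>m\<close> on.\<close>

definition abschnitt :: "nat \<Rightarrow> ((nat \<Rightarrow> complex) \<Rightarrow> complex) \<Rightarrow> (nat \<Rightarrow> complex) \<Rightarrow> complex" where
  "abschnitt m f z =
     (\<Sum>\<^sub>\<infinity>\<nu>\<in>{\<nu> :: nat \<Rightarrow> nat. \<forall>n\<ge>m. \<nu> n = 0}.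
        fourier_coeff f (\<lambda>n. int (\<nu> n)) * (\<Prod>n<m. z n ^ \<nu> n))"

text \<open>For \<open>f\<close> in \<open>H\<^sup>\<infinity>(\<T>\<^sup>\<infinity>)\<close> and \<open>z\<close> in \<^term>\<open>polydisc_c0\<close> the series above converge absolutely
  and the limit below exists.\<close>

definition point_eval :: "((nat \<Rightarrow> complex) \<Rightarrow> complex) \<Rightarrow> (nat \<Rightarrow> complex) \<Rightarrow> complex" where
  "point_eval f z = lim (\<lambda>m. abschnitt m f z)"

definition radial_approach :: "(nat \<Rightarrow> nat \<Rightarrow> real) \<Rightarrow> bool" where
  "radial_approach r \<longleftrightarrow>
     (\<forall>n k. 0 \<le> r n k \<and> r n k < 1) \<and>
     (\<forall>k. (\<lambda>n. r n k) \<longlonglongrightarrow> 0) \<and>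
     (\<forall>n. (\<lambda>k. r n k) \<longlonglongrightarrow> 1)"

definition approach_point :: "(nat \<Rightarrow> nat \<Rightarrow> real) \<Rightarrow> (nat \<Rightarrow> complex) \<Rightarrow> nat \<Rightarrow> nat \<Rightarrow> complex" where
  "approach_point r w k = (\<lambda>n. of_real (r n k) * w n)"

definition has_unrestricted_radial_limit ::
    "((nat \<Rightarrow> complex) \<Rightarrow> complex) \<Rightarrow> (nat \<Rightarrow> complex) \<Rightarrow> bool" where
  "has_unrestricted_radial_limit f w \<longleftrightarrow>
     (\<exists>L. \<forall>r. radial_approach r \<longrightarrow> (\<lambda>k. point_eval f (approach_point r w k)) \<longlonglongrightarrow> L)"

lemma cis_measurable_circle:
  "cis \<in> uniform_measure lborel {0..2 * pi} \<rightarrow>\<^sub>M restrict_space borel (sphere 0 1)"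
proof (rule measurable_restrict_space2)
  have "cis \<in> borel_measurable borel"
    by (intro borel_measurable_continuous_onI continuous_intros)
  then show "cis \<in> borel_measurable (uniform_measure lborel {0..2 * pi})"
    by (simp add: measurable_def)
qed auto

lemma prob_space_circle_measure: "prob_space circle_measure"
  unfolding circle_measure_def
  by (intro prob_space.prob_space_distr prob_space_uniform_measure cis_measurable_circle) auto

lemma prob_space_torus: "prob_space torus"
  unfolding torus_def by (intro prob_space_PiM prob_space_circle_measure)

lemma space_torus: "space torus = {z. \<forall>n. norm (z n) = 1}"
  by (auto simp: torus_def circle_measure_def space_PiM space_restrict_space PiE_iff)

end

theory Submission
  imports Defs "HOL-Complex_Analysis.Cauchy_Integral_Formula"
begin

text \<open>
  The function is an infinite product of zero-free functions of one variable each. With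
  \<open>h(z) = (1 + z) / (1 - z)\<close>, so that \<open>Re h\<close> is the Poisson kernel of the disc, put
  \<open>f(z) = exp (- (\<Sum>j. \<epsilon>\<^sub>j h(s\<^sub>j z\<^sub>j)))\<close> with \<open>\<epsilon>\<^sub>j = 2\<^sup>-\<^sup>I\<close>, \<open>s\<^sub>j = 1 - 2\<^sup>-\<^sup>I\<^sup>-\<^sup>1\<close>, where the exponent \<open>I\<close> depends on \<open>j\<close>.
  The exponents are chosen such that \<open>\<Sum>\<epsilon>\<^sub>j < \<infinity>\<close> while \<open>\<Sum>\<epsilon>\<^sub>j log (1/\<epsilon>\<^sub>j) = \<infinity>\<close>, and these two facts pull in
  opposite directions.

  The first one makes \<open>f\<close> a good function. For \<open>z\<close> in the polydisc with \<open>z\<^sub>j \<longlonglongrightarrow> 0\<close> the exponent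
  converges absolutely, so \<open>f\<close> has no zeros there and \<open>|f(z)| = exp (- (\<Sum>j. \<epsilon>\<^sub>j Re h(s\<^sub>j z\<^sub>j)))\<close>
  (\<open>norm_point_eval\<close>). On the torus \<open>Re h(s\<^sub>j w\<^sub>j)\<close> has mean 1, so the sum of the real parts is
  finite almost everywhere and the boundary function, once it exists, does not vanish
  (\<open>AE_infinite_product_nonzero\<close>). It exists as the limit of the partial products taken at the ends
  of suitable blocks of variables (\<open>AE_partial_product_tendsto\<close>): the product \<open>G\<close> over a block is
  bounded by 1 and has mean \<open>exp (- \<delta>)\<close>, where \<open>\<delta>\<close> is the sum of the \<open>\<epsilon>\<^sub>j\<close> in the block, so that
  \<open>\<integral>|G - 1|\<^sup>2 \<le> 2\<delta>\<close>.

  The second one makes radial limits fail. At the radius \<open>1 - |w\<^sub>j - 1|\<close> the Poisson kernel has size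
  about \<open>1 / |w\<^sub>j - 1|\<close>, so its maximum over the radii dominates a function \<open>Y\<^sub>j\<close> whose mean is
  at least a constant times \<open>I = log\<^sub>2 (1/\<epsilon>\<^sub>j)\<close>, because every one of the \<open>I + 1\<close> dyadic scales contributes
  a comparable amount. The block sums of \<open>\<epsilon>\<^sub>jY\<^sub>j\<close> therefore have large means, and since the variables are independent,
  the means of \<open>exp (- (\<Sum>\<epsilon>\<^sub>jY\<^sub>j))\<close> over the blocks form a summable sequence; hence almost everywhere
  these exponentials tend to 0 (\<open>AE_exp_block_minorant_tendsto_0\<close>). Thus for almost every \<open>w\<close> and every
  large \<open>m\<close> there are radii for the variables of block \<open>m\<close> that make \<open>|f|\<close> small, whatever the radii in
  the earlier blocks are.

  For an increasing approach chosen for the point \<open>w\<close>, the radii of block \<open>m\<close> are set to these bad values at stage \<open>m\<close>, when all later radii are still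
  0, and they increase to 1 afterwards (\<open>ex_increasing_approach_to_0\<close>). For an approach that
  serves almost all points at once, one observes that the bad radii can be taken from a finite set depending only on the block, so that a single
  sequence can run through all combinations of all blocks; almost every point then meets its bad
  combination infinitely often (\<open>ex_universal_approach\<close>). Since \<open>f(w) \<noteq> 0\<close>, the values do not converge
  to \<open>f(w)\<close>. Finally, an approach that lets only finitely many coordinates be nonzero at a time, and
  brings each of them close enough to the boundary, keeps \<open>|f|\<close> away from 0
  (\<open>ex_approach_bounded_below\<close>), so the limit along all approaches cannot exist.
\<close>

section \<open>Fourier coefficients on the circle\<close>

interpretation circle: prob_space circle_measure
  by (rule prob_space_circle_measure)

lemma space_circle: "space circle_measure = sphere 0 1"
  by (simp add: circle_measure_def space_restrict_space)

lemma borel_measurable_circle: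
  "continuous_on (sphere 0 1) g \<Longrightarrow> g \<in> borel_measurable circle_measure"
  unfolding circle_measure_def by (simp add: borel_measurable_continuous_on_restrict)

lemma integrable_circle:
  fixes g :: "complex \<Rightarrow> 'b::{banach, second_countable_topology}"
  assumes "continuous_on (sphere 0 1) g"
  shows "integrable circle_measure g"
proof -
  have "compact (g ` sphere 0 1)"
    by (intro compact_continuous_image assms compact_sphere)
  then obtain B where "\<And>w. w \<in> sphere 0 1 \<Longrightarrow> norm (g w) \<le> B"
    using compact_imp_bounded bounded_iff by (metis imageI)
  then show ?thesis
    by (intro circle.integrable_const_bound[where B = B] borel_measurable_circle assms AE_I2)
       (simp add: space_circle)
qed

lemma circle_integral_powi: "(LINT w|circle_measure. w powi k) = (if k = 0 then 1 else 0)"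
proof (cases "k = 0")
  case True
  then show ?thesis using circle.prob_space by simp
next
  case False
  let ?d = "\<lambda>t::real. indicator {0..2 * pi} t / (2 * pi)"
  have u: "uniform_measure lborel {0..2 * pi} = density lborel (\<lambda>t. ennreal (?d t))"
    unfolding uniform_measure_def
    by (rule density_cong) (auto simp: indicator_def divide_ennreal ennreal_1[symmetric] simp del: ennreal_1)
  have m: "(\<lambda>w. w powi k) \<in> borel_measurable (restrict_space borel (sphere 0 1) :: complex measure)"
    by (intro borel_measurable_continuous_on_restrict continuous_intros) auto
  have FTC: "(LINT t|lborel. indicator {0..2 * pi} t *\<^sub>R cis (of_int k * t)) =
      cis (of_int k * (2 * pi)) / (\<i> * of_int k) - cis (of_int k * 0) / (\<i> * of_int k)"
  proof (rule integral_FTC_Icc)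
    fix t :: real
    have "((\<lambda>z. exp (\<i> * of_int k * z) / (\<i> * of_int k)) has_field_derivative
        exp (\<i> * of_int k * of_real t)) (at (of_real t))"
      using False by (auto intro!: derivative_eq_intros)
    from has_vector_derivative_real_field[OF this]
    show "((\<lambda>t. cis (of_int k * t) / (\<i> * of_int k)) has_vector_derivative cis (of_int k * t))
        (at t within {0..2 * pi})"
      by (simp add: cis_conv_exp mult.assoc)
  qed (auto intro!: continuous_intros)
  have "(LINT w|circle_measure. w powi k) =
      (LINT t|uniform_measure lborel {0..2 * pi}. cis t powi k)"
    unfolding circle_measure_def by (rule integral_distr[OF cis_measurable_circle m])
  also have "\<dots> = (LINT t|lborel. ?d t *\<^sub>R cis (of_int k * t))"
    unfolding u cis_power_int
    by (rule integral_density) (auto intro!: borel_measurable_continuous_onI continuous_intros)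
  also have "\<dots> = (LINT t|lborel. (1 / (2 * pi)) *\<^sub>R (indicator {0..2 * pi} t *\<^sub>R cis (of_int k * t)))"
    by (rule Bochner_Integration.integral_cong) auto
  also have "\<dots> = 0"
    unfolding integral_scaleR_right FTC
    using cis_multiple_2pi[of "of_int k"] by (simp add: mult.commute mult.left_commute)
  finally show ?thesis using False by simp
qed

lemma cnj_powi_unimodular:
  assumes "norm w = 1" shows "cnj (w powi k) = w powi (- k)"
proof -
  have "cnj w = inverse w"
    using assms by (simp add: inverse_eq_divide divide_conv_cnj)
  then show ?thesis
    by (simp add: power_int_inverse power_int_minus)
qed

text \<open>
  Absolute summability of the coefficients makes the series converge uniformly on the circle, so it may be
  integrated term by term, and only one monomial survives.
\<close>
lemma circle_fourier_power_series:
  fixes a :: "nat \<Rightarrow> complex"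
  assumes a: "summable (\<lambda>n. norm (a n))"
    and g: "\<And>w. norm w = 1 \<Longrightarrow> (\<lambda>n. a n * w ^ n) sums g w"
  shows "(LINT w|circle_measure. g w * cnj (w powi k)) = (if 0 \<le> k then a (nat k) else 0)"
proof -
  let ?t = "\<lambda>n w. a n * w powi (int n - k)"
  have int: "integrable circle_measure (?t n)" for n
    by (intro integrable_circle continuous_intros) auto
  have tn: "norm (?t n w) = norm (a n)" if "norm w = 1" for n w
    using that by (simp add: norm_mult norm_power_int)
  have "(LINT w|circle_measure. g w * cnj (w powi k)) = (LINT w|circle_measure. (\<Sum>n. ?t n w))"
  proof (rule Bochner_Integration.integral_cong[OF refl])
    fix w assume "w \<in> space circle_measure"
    then have w: "norm w = 1" "w \<noteq> 0" by (auto simp: space_circle)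
    have "(\<lambda>n. a n * w ^ n * w powi (- k)) sums (g w * w powi (- k))"
      by (intro sums_mult2 g w)
    moreover have "a n * w ^ n * w powi (- k) = ?t n w" for n
      using w by (simp add: power_int_diff power_int_minus field_simps)
    ultimately show "g w * cnj (w powi k) = (\<Sum>n. ?t n w)"
      using w(1) by (simp only: cnj_powi_unimodular sums_iff)
  qed
  also have "\<dots> = (\<Sum>n. LINT w|circle_measure. ?t n w)"
  proof (rule integral_suminf[OF int])
    show "AE w in circle_measure. summable (\<lambda>n. norm (?t n w))"
      using a tn by (intro AE_I2) (simp add: space_circle)
    have "(LINT w|circle_measure. norm (?t n w)) = (LINT w|circle_measure. norm (a n))" for n
      by (rule Bochner_Integration.integral_cong[OF refl]) (use tn in \<open>simp add: space_circle\<close>)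
    then show "summable (\<lambda>n. LINT w|circle_measure. norm (?t n w))"
      using a circle.prob_space by simp
  qed
  also have "\<dots> = (\<Sum>n. if int n = k then a n else 0)"
    by (intro suminf_cong) (simp add: circle_integral_powi)
  also have "\<dots> = (if 0 \<le> k then a (nat k) else 0)"
  proof (cases "0 \<le> k")
    case True
    then have "int n = k \<longleftrightarrow> n = nat k" for n by auto
    then show ?thesis using True sums_single[of "nat k" a] by (simp add: sums_iff)
  next
    case False
    then have "int n \<noteq> k" for n by auto
    then show ?thesis using False by simp
  qed
  finally show ?thesis .
qed

definition taylor_coeff :: "(complex \<Rightarrow> complex) \<Rightarrow> nat \<Rightarrow> complex" where
  "taylor_coeff g n = (deriv ^^ n) g 0 / fact n"

lemma taylor_coeff_0: "taylor_coeff g 0 = g 0"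
  by (simp add: taylor_coeff_def)

text \<open>
  Convergence at a real point beyond 1 gives absolute convergence on the whole closed unit disc.
\<close>
lemma taylor_series:
  assumes g: "g holomorphic_on ball 0 R" and R: "1 < R" and z: "norm z \<le> 1"
  shows "(\<lambda>n. taylor_coeff g n * z ^ n) sums g z"
    and "summable (\<lambda>n. norm (taylor_coeff g n * z ^ n))"
proof -
  have sums: "(\<lambda>n. taylor_coeff g n * z ^ n) sums g z" if "norm z < R" for z
    using holomorphic_power_series[OF g, of z] that by (simp add: taylor_coeff_def)
  show "(\<lambda>n. taylor_coeff g n * z ^ n) sums g z"
    using sums z R by simp
  obtain x :: real where x: "1 < x" "x < R" using dense[OF R] by blast
  have "summable (\<lambda>n. taylor_coeff g n * (of_real x) ^ n)"
    using sums[of "of_real x"] x by (auto simp: sums_iff)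
  then show "summable (\<lambda>n. norm (taylor_coeff g n * z ^ n))"
    by (rule powser_insidea) (use x z in simp)
qed

lemma circle_fourier_holomorphic:
  assumes g: "g holomorphic_on ball 0 R" and R: "1 < R"
  shows "(LINT w|circle_measure. g w * cnj (w powi k)) = (if 0 \<le> k then taylor_coeff g (nat k) else 0)"
  using taylor_series[OF g R] taylor_series(2)[OF g R, of 1]
  by (intro circle_fourier_power_series) auto

lemma circle_mean_value:
  assumes "g holomorphic_on ball 0 R" "1 < R"
  shows "(LINT w|circle_measure. g w) = g 0"
  using circle_fourier_holomorphic[OF assms, of 0] by (simp add: taylor_coeff_0)

text \<open>
  On the arc of angles in \<open>[0, d]\<close> the distance to 1 is at most the angle.
\<close>
lemma circle_measure_near_1:
  assumes "0 \<le> d" "d \<le> 1"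
  shows "d / (2 * pi) \<le> measure circle_measure (sphere 0 1 \<inter> cball 1 d)"
proof -
  let ?U = "uniform_measure lborel {0..2 * pi}" and ?A = "sphere 0 1 \<inter> cball 1 d :: complex set"
  have A: "?A \<in> sets (restrict_space borel (sphere 0 1))"
    by (auto simp: sets_restrict_space)
  have "measure circle_measure ?A = measure ?U (cis -` ?A \<inter> space ?U)"
    unfolding circle_measure_def by (rule measure_distr[OF cis_measurable_circle A])
  moreover have "measure ?U {0..d} \<le> measure ?U (cis -` ?A \<inter> space ?U)"
  proof (rule finite_measure.finite_measure_mono)
    show "finite_measure ?U"
      by (rule prob_space.finite_measure, rule prob_space_uniform_measure) auto
    have "dist 1 (cis t) \<le> d" if "0 \<le> t" "t \<le> d" for t
      using iexp_approx1[of t 0] that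
      by (simp add: dist_norm norm_minus_commute cis_conv_exp)
    then show "{0..d} \<subseteq> cis -` ?A \<inter> space ?U"
      by auto
    show "cis -` ?A \<inter> space ?U \<in> sets ?U"
      by (rule measurable_sets[OF cis_measurable_circle A])
  qed
  moreover have "measure ?U {0..d} = d / (2 * pi)"
  proof -
    have "{0..2 * pi} \<inter> {0..d} = {0..d}"
      using assms pi_ge_two by auto
    then show ?thesis using assms by (simp add: measure_uniform_measure)
  qed
  ultimately show ?thesis by simp
qed

section \<open>Integration over the infinite torus\<close>

interpretation torus: prob_space torus
  by (rule prob_space_torus)

lemma borel_measurable_torus_component:
  "h \<in> borel_measurable circle_measure \<Longrightarrow> (\<lambda>w. h (w j)) \<in> borel_measurable torus"
  unfolding torus_def by (rule measurable_compose[OF measurable_component_singleton]) auto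

text \<open>
  Independence of the coordinates. The product depends on finitely many coordinates only, and the projection
  to these carries the infinite product measure to the finite one, where Fubini applies.
\<close>
lemma
  fixes h :: "nat \<Rightarrow> complex \<Rightarrow> 'b::{real_normed_field, banach, second_countable_topology}"
  assumes J: "finite J" and h: "\<And>j. j \<in> J \<Longrightarrow> integrable circle_measure (h j)"
  shows integrable_torus_prod: "integrable torus (\<lambda>w. \<Prod>j\<in>J. h j (w j))"
    and integral_torus_prod:
      "(LINT w|torus. (\<Prod>j\<in>J. h j (w j))) = (\<Prod>j\<in>J. LINT z|circle_measure. h j z)"
proof -
  interpret product_prob_space "\<lambda>_::nat. circle_measure" UNIV
    by unfold_locales
  let ?P = "PiM J (\<lambda>_. circle_measure)"
  have P: "distr torus ?P (\<lambda>w. restrict w J) = ?P"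
    unfolding torus_def by (rule distr_PiM_restrict_finite[OF J]) auto
  have m: "(\<lambda>w. restrict w J) \<in> torus \<rightarrow>\<^sub>M ?P"
    unfolding torus_def by (rule measurable_restrict_subset) auto
  have i: "integrable ?P (\<lambda>x. \<Prod>j\<in>J. h j (x j))"
    by (rule product_integrable_prod[OF J h])
  then have mb: "(\<lambda>x. \<Prod>j\<in>J. h j (x j)) \<in> borel_measurable ?P"
    by (rule borel_measurable_integrable)
  have "integrable (distr torus ?P (\<lambda>w. restrict w J)) (\<lambda>x. \<Prod>j\<in>J. h j (x j))"
    unfolding P by (rule i)
  then show "integrable torus (\<lambda>w. \<Prod>j\<in>J. h j (w j))"
    by (subst (asm) integrable_distr_eq[OF m mb]) (simp cong: prod.cong)
  have "(LINT x|distr torus ?P (\<lambda>w. restrict w J). (\<Prod>j\<in>J. h j (x j))) =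
      (LINT w|torus. (\<Prod>j\<in>J. h j (w j)))"
    by (subst integral_distr[OF m mb]) (simp cong: prod.cong)
  then have "(LINT w|torus. (\<Prod>j\<in>J. h j (w j))) = (LINT x|?P. (\<Prod>j\<in>J. h j (x j)))"
    unfolding P by (rule sym)
  also have "\<dots> = (\<Prod>j\<in>J. LINT z|circle_measure. h j z)"
    by (rule product_integral_prod[OF J h])
  finally show "(LINT w|torus. (\<Prod>j\<in>J. h j (w j))) = (\<Prod>j\<in>J. LINT z|circle_measure. h j z)" .
qed

text \<open>
  The one device by which means are turned into almost sure statements below; it stands in for
  the Borel--Cantelli lemma.
\<close>
lemma AE_summable_of_summable_integrals:
  fixes f :: "nat \<Rightarrow> 'a \<Rightarrow> real"
  assumes int: "\<And>n. integrable M (f n)" and nonneg: "\<And>n. AE x in M. 0 \<le> f n x"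
    and sum: "summable (\<lambda>n. LINT x|M. f n x)"
  shows "AE x in M. summable (\<lambda>n. f n x)"
proof -
  have [measurable]: "f n \<in> borel_measurable M" for n
    using int by (rule borel_measurable_integrable)
  have 0: "0 \<le> (LINT x|M. f n x)" for n
    by (rule integral_nonneg_AE[OF nonneg])
  have "(\<integral>\<^sup>+x. (\<Sum>n. ennreal (f n x)) \<partial>M) = (\<Sum>n. \<integral>\<^sup>+x. ennreal (f n x) \<partial>M)"
    by (rule nn_integral_suminf) measurable
  also have "\<dots> = (\<Sum>n. ennreal (LINT x|M. f n x))"
    by (intro suminf_cong nn_integral_eq_integral int nonneg)
  also have "\<dots> \<noteq> \<infinity>"
    using suminf_ennreal2[OF 0 sum] by simp
  finally have "(\<integral>\<^sup>+x. (\<Sum>n. ennreal (f n x)) \<partial>M) \<noteq> \<infinity>" .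
  then have "AE x in M. (\<Sum>n. ennreal (f n x)) \<noteq> \<infinity>"
    by (intro nn_integral_PInf_AE) measurable
  moreover have "AE x in M. \<forall>n. 0 \<le> f n x"
    using nonneg by (simp add: AE_all_countable)
  ultimately show ?thesis
  proof eventually_elim
    fix x assume "(\<Sum>n. ennreal (f n x)) \<noteq> \<infinity>" and pos: "\<forall>n. 0 \<le> f n x"
    then have "(\<Sum>n. ennreal (f n x)) \<noteq> top" by simp
    then show "summable (\<lambda>n. f n x)"
      using pos by (intro summable_suminf_not_top) blast
  qed
qed

lemma AE_torus_unimodular: "AE w in torus. \<forall>n. norm (w n) = 1"
  by (rule AE_I2) (simp add: space_torus)

section \<open>The Poisson kernel near the boundary\<close>

text \<open>
  The conformal map of the disc onto the right half plane; its real part is the Poisson kernel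
  with singularity at 1.
\<close>
definition herglotz :: "complex \<Rightarrow> complex" where
  "herglotz z = (1 + z) / (1 - z)"

lemma herglotz_holomorphic: "herglotz holomorphic_on ball 0 1"
  unfolding herglotz_def by (intro holomorphic_intros) auto

lemma Re_herglotz: "Re (herglotz z) = (1 - (norm z)\<^sup>2) / (norm (1 - z))\<^sup>2"
proof -
  have "herglotz z = (1 + z) * cnj (1 - z) / of_real ((norm (1 - z))\<^sup>2)"
    unfolding herglotz_def by (rule complex_div_cnj)
  then have "Re (herglotz z) = Re ((1 + z) * cnj (1 - z)) / (norm (1 - z))\<^sup>2"
    by (simp only: Re_divide_of_real)
  moreover have "Re ((1 + z) * cnj (1 - z)) = 1 - (norm z)\<^sup>2"
    unfolding cmod_power2 by (simp add: algebra_simps power2_eq_square)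
  ultimately show ?thesis by simp
qed

lemma Re_herglotz_nonneg: "norm z < 1 \<Longrightarrow> 0 \<le> Re (herglotz z)"
  by (simp add: Re_herglotz power_le_one)

lemma norm_herglotz_le: assumes "norm z \<le> 1 / 2" shows "norm (herglotz z) \<le> 3"
proof -
  have "norm (1 + z) \<le> 3 / 2" "1 / 2 \<le> norm (1 - z)"
    using assms norm_triangle_ineq[of 1 z] norm_triangle_ineq2[of 1 z] by auto
  then show ?thesis
    by (simp add: herglotz_def norm_divide divide_simps)
qed

text \<open>
  If \<open>w\<close> is within \<open>d\<close> of 1, then \<open>(1 - d) w\<close> is within \<open>2 d\<close> of 1, while its distance to the circle
  is \<open>d\<close>; hence the kernel is at least of order \<open>d / (2 d)\<^sup>2\<close>.
\<close>
lemma Re_herglotz_dyadic: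
  assumes w: "norm w = 1" and near: "norm (w - 1) \<le> d" and d: "0 < d" "d \<le> 1"
  shows "1 / (4 * d) \<le> Re (herglotz (of_real (1 - d) * w))"
proof -
  let ?\<rho> = "1 - d"
  have "norm (1 - of_real ?\<rho> * w) = norm (of_real d - of_real ?\<rho> * (w - 1))"
    by (simp add: algebra_simps)
  also have "\<dots> \<le> norm (of_real d :: complex) + norm (of_real ?\<rho> * (w - 1))"
    by (rule norm_triangle_ineq4)
  also have "\<dots> = d + ?\<rho> * norm (w - 1)"
    using d by (simp add: norm_mult del: of_real_diff)
  also have "\<dots> \<le> d + 1 * d"
    using d near by (intro add_left_mono mult_mono) auto
  finally have le: "norm (1 - of_real ?\<rho> * w) \<le> 2 * d" by simp
  have n: "norm (of_real ?\<rho> * w) = ?\<rho>"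
    using d w by (simp add: norm_mult del: of_real_diff)
  have "1 - of_real ?\<rho> * w \<noteq> 0"
    using n d by auto
  then have pos: "0 < (norm (1 - of_real ?\<rho> * w))\<^sup>2" by simp
  have "1 / (4 * d) = d / (2 * d)\<^sup>2"
    using d by (simp add: power2_eq_square)
  also have "\<dots> \<le> d / (norm (1 - of_real ?\<rho> * w))\<^sup>2"
    using le pos d by (intro divide_left_mono power_mono) auto
  also have "\<dots> \<le> (1 - ?\<rho>\<^sup>2) / (norm (1 - of_real ?\<rho> * w))\<^sup>2"
  proof (rule divide_right_mono)
    have "d * d \<le> d * 1" using d by (intro mult_left_mono) auto
    then show "d \<le> 1 - ?\<rho>\<^sup>2" by (simp add: power2_eq_square algebra_simps)
  qed simp
  finally show ?thesis
    unfolding Re_herglotz n .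
qed

text \<open>
  A lower bound, up to scale \<open>2\<^sup>-\<^sup>I\<close>, for the maximum of the Poisson kernel along the radius through \<open>w\<close>.
  Writing it as a sum over scales, instead of as the largest scale that applies, makes its mean a
  sum of equal contributions.
\<close>
definition dyadic_minorant :: "nat \<Rightarrow> complex \<Rightarrow> real" where
  "dyadic_minorant I w = (\<Sum>i\<le>I. 2 ^ i / 8 * indicator (sphere 0 1 \<inter> cball 1 ((1/2) ^ i)) w)"

lemma dyadic_minorant_nonneg: "0 \<le> dyadic_minorant I w"
  unfolding dyadic_minorant_def by (intro sum_nonneg) auto

lemma sum_powers_of_2_eighths: "(\<Sum>i\<le>n. 2 ^ i / 8 :: real) = (2 * 2 ^ n - 1) / 8"
  by (induction n) (simp_all add: field_simps)

text \<open>
  The witness is the finest scale at which \<open>w\<close> is still close to 1, or the centre of the disc if there is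
  none: the sum of powers of 2 in the minorant is at
  most twice its last term, and this term is what \<open>Re_herglotz_dyadic\<close> provides at that scale.
\<close>
lemma dyadic_minorant_le_herglotz:
  assumes w: "norm w = 1"
  shows "\<exists>i\<le>I. dyadic_minorant I w \<le> Re (herglotz (of_real (1 - (1/2) ^ i) * w))"
proof -
  let ?K = "{i. i \<le> I \<and> norm (w - 1) \<le> (1/2) ^ i}"
  have D: "dyadic_minorant I w = (\<Sum>i\<in>?K. 2 ^ i / 8)"
    unfolding dyadic_minorant_def
    by (intro sum.mono_neutral_cong_right)
       (use w in \<open>auto simp: dist_norm norm_minus_commute indicator_def\<close>)
  show ?thesis
  proof (cases "?K = {}")
    case True
    have "Re (herglotz (of_real (1 - (1/2) ^ 0) * w)) = 1"
      by (simp add: herglotz_def)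
    then show ?thesis using D True by (intro exI[of _ 0]) simp
  next
    case False
    define i where "i = Max ?K"
    have fin: "finite ?K" by (rule finite_subset[of _ "{..I}"]) auto
    have i: "i \<le> I" "norm (w - 1) \<le> (1/2) ^ i"
      using Max_in[OF fin False] unfolding i_def by auto
    have "dyadic_minorant I w \<le> (\<Sum>k\<le>i. 2 ^ k / 8)"
      unfolding D by (intro sum_mono2) (auto simp: i_def Max_ge[OF fin])
    also have "\<dots> = (2 * 2 ^ i - 1) / 8"
      by (rule sum_powers_of_2_eighths)
    also have "\<dots> \<le> 1 / (4 * (1/2) ^ i)"
      by (simp add: power_one_over field_simps)
    also have "\<dots> \<le> Re (herglotz (of_real (1 - (1/2) ^ i) * w))"
      by (intro Re_herglotz_dyadic w i) (auto simp: power_le_one)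
    finally show ?thesis using i by blast
  qed
qed

lemma dyadic_minorant_le: "dyadic_minorant I w \<le> 2 ^ I"
proof -
  have "dyadic_minorant I w \<le> (\<Sum>i\<le>I. 2 ^ i / 8)"
    unfolding dyadic_minorant_def by (intro sum_mono) (simp add: indicator_def)
  also have "\<dots> = (2 * 2 ^ I - 1) / 8"
    by (rule sum_powers_of_2_eighths)
  also have "\<dots> \<le> 2 ^ I" by (simp add: field_simps)
  finally show ?thesis .
qed

lemma sphere_cball_measurable: "sphere 0 1 \<inter> cball 1 d \<in> sets circle_measure"
  by (auto simp: circle_measure_def sets_restrict_space)

lemma borel_measurable_dyadic_minorant: "dyadic_minorant I \<in> borel_measurable circle_measure"
  unfolding dyadic_minorant_def[abs_def] using sphere_cball_measurable by measurable

text \<open>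
  The factor \<open>2\<^sup>i\<close> cancels the probability of being within \<open>2\<^sup>-\<^sup>i\<close> of 1, so all scales contribute alike and
  the mean grows linearly in the number of scales. This is the source of the divergence.
\<close>
lemma dyadic_minorant_mean:
  "real (Suc I) / (16 * pi) \<le> (LINT w|circle_measure. dyadic_minorant I w)"
proof -
  have "(LINT w|circle_measure. dyadic_minorant I w) =
      (\<Sum>i\<le>I. 2 ^ i / 8 * measure circle_measure (sphere 0 1 \<inter> cball 1 ((1/2) ^ i)))"
    unfolding dyadic_minorant_def
    by (subst Bochner_Integration.integral_sum)
       (auto intro!: sphere_cball_measurable simp: circle.emeasure_eq_measure Int_absorb2 sets.sets_into_space sphere_cball_measurable)
  moreover have "(\<Sum>i\<le>I. 1 / (16 * pi)) \<le> \<dots>"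
  proof (rule sum_mono)
    fix i
    have "1 / (16 * pi) = 2 ^ i / 8 * ((1/2) ^ i / (2 * pi))"
      by (simp add: power_one_over)
    also have "\<dots> \<le> 2 ^ i / 8 * measure circle_measure (sphere 0 1 \<inter> cball 1 ((1/2) ^ i))"
      by (intro mult_left_mono circle_measure_near_1) (auto simp: power_le_one)
    finally show "1 / (16 * pi) \<le> 2 ^ i / 8 * measure circle_measure (sphere 0 1 \<inter> cball 1 ((1/2) ^ i))" .
  qed
  ultimately show ?thesis by simp
qed

text \<open>
  A Chernoff-type bound: exponentials multiply over independent coordinates, so that no
  variance has to be estimated later. The hypothesis keeps the exponent in \<open>[0, 1]\<close>, where
  \<open>exp (- x) \<le> 1 - x / 2\<close>.
\<close>
lemma dyadic_minorant_laplace: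
  assumes e: "0 \<le> e" "e * 2 ^ I \<le> 1"
  shows "(LINT w|circle_measure. exp (- e * dyadic_minorant I w)) \<le> exp (- e * (real (Suc I) / (32 * pi)))"
proof -
  have le: "exp (- x) \<le> 1 - x / 2" if "0 \<le> x" "x \<le> 1" for x :: real
  proof -
    have "1 + x \<le> exp x" by simp
    then have "exp (- x) \<le> 1 / (1 + x)"
      using that by (simp add: exp_minus inverse_eq_divide frac_le)
    also have "\<dots> \<le> 1 - x / 2"
    proof -
      have "x * x \<le> x * 1" using that by (intro mult_left_mono) auto
      then show ?thesis using that by (simp add: field_simps)
    qed
    finally show ?thesis .
  qed
  note borel_measurable_dyadic_minorant[measurable]
  have D: "0 \<le> e * dyadic_minorant I w" "e * dyadic_minorant I w \<le> 1" for w
    using e dyadic_minorant_nonneg mult_left_mono[OF dyadic_minorant_le e(1), of I w] by auto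
  have int: "integrable circle_measure (dyadic_minorant I)"
    using dyadic_minorant_nonneg dyadic_minorant_le
    by (intro circle.integrable_const_bound[where B = "2 ^ I"] AE_I2) auto
  have "(LINT w|circle_measure. exp (- e * dyadic_minorant I w)) \<le>
      (LINT w|circle_measure. 1 - e * dyadic_minorant I w / 2)"
  proof (rule integral_mono)
    show "integrable circle_measure (\<lambda>w. exp (- e * dyadic_minorant I w))"
      using D by (intro circle.integrable_const_bound[where B = 1] AE_I2) auto
    show "exp (- e * dyadic_minorant I w) \<le> 1 - e * dyadic_minorant I w / 2" for w
      using le[OF D] by simp
  qed (use int in auto)
  also have "\<dots> = 1 - e / 2 * (LINT w|circle_measure. dyadic_minorant I w)"
    using int circle.prob_space by simp
  also have "\<dots> \<le> 1 - e / 2 * (real (Suc I) / (16 * pi))"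
    using e dyadic_minorant_mean[of I] mult_left_mono[of _ _ "e / 2"] by fastforce
  also have "\<dots> \<le> exp (- (e / 2 * (real (Suc I) / (16 * pi))))"
    by (rule order_trans[OF _ exp_ge_add_one_self]) simp
  finally show ?thesis by simp
qed

section \<open>Blocks of variables\<close>

text \<open>
  Block \<open>m\<close> consists of \<open>2\<^sup>b\<close> variables of weight \<open>2\<^sup>-\<^sup>b\<^sup>-\<^sup>2\<^sup>m\<close>, where \<open>b\<close> is \<open>block_bits m\<close>. Its total weight \<open>4\<^sup>-\<^sup>m\<close>
  is small enough for the convergence of the block products. The logarithm of the reciprocal weight is at
  least \<open>b\<close>, and \<open>b\<close> is so large that the total weight times \<open>b\<close> still tends to infinity; the
  constant 128 makes the resulting bound in \<open>integral_exp_block_minorant_le\<close> come out as \<open>exp (- m)\<close>.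
\<close>
definition block_bits :: "nat \<Rightarrow> nat" where
  "block_bits m = 128 * m * 4 ^ m"

definition block_start :: "nat \<Rightarrow> nat" where
  "block_start m = (\<Sum>i<m. 2 ^ block_bits i)"

definition block :: "nat \<Rightarrow> nat set" where
  "block m = {block_start m..<block_start (Suc m)}"

definition block_of :: "nat \<Rightarrow> nat" where
  "block_of j = (LEAST m. j < block_start (Suc m))"

definition depth :: "nat \<Rightarrow> nat" where
  "depth j = block_bits (block_of j) + 2 * block_of j"

definition weight :: "nat \<Rightarrow> real" where
  "weight j = (1/2) ^ depth j"

text \<open>
  The dilation keeps each factor holomorphic beyond the closed disc. It is closer to 1 than the finest
  scale \<open>2\<^sup>-\<^sup>I\<close>, with \<open>I\<close> the depth, so that all scales up to the depth are reached by radii below 1.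
\<close>
definition dilation :: "nat \<Rightarrow> real" where
  "dilation j = 1 - (1/2) ^ Suc (depth j)"

lemma block_start_Suc: "block_start (Suc m) = block_start m + 2 ^ block_bits m"
  by (simp add: block_start_def)

lemma strict_mono_block_start: "strict_mono block_start"
  by (simp add: strict_mono_Suc_iff block_start_Suc)

lemma le_block_start: "m \<le> block_start m"
  by (rule strict_mono_imp_increasing[OF strict_mono_block_start])

lemma block_start_mono: "m \<le> n \<Longrightarrow> block_start m \<le> block_start n"
  by (rule monoD[OF strict_mono_mono[OF strict_mono_block_start]])

lemma finite_block: "finite (block m)"
  by (simp add: block_def)

lemma card_block: "card (block m) = 2 ^ block_bits m"
  by (simp add: block_def block_start_Suc)

text \<open>
  Consecutive blocks are disjoint intervals, so the first block that ends beyond \<open>j\<close> is the one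
  that contains \<open>j\<close>.
\<close>
lemma block_of_eq:
  assumes "j \<in> block m" shows "block_of j = m"
  unfolding block_of_def
proof (rule Least_equality)
  show "j < block_start (Suc m)" using assms by (simp add: block_def)
  fix k assume k: "j < block_start (Suc k)"
  show "m \<le> k"
  proof (rule ccontr)
    assume "\<not> m \<le> k"
    then have "block_start (Suc k) \<le> block_start m" by (intro block_start_mono) simp
    then show False using k assms by (simp add: block_def)
  qed
qed

lemma in_block_of: "j \<in> block (block_of j)"
proof -
  have "\<exists>m. j < block_start (Suc m)"
    using le_block_start[of "Suc j"] by (intro exI[of _ j]) simp
  then have lt: "j < block_start (Suc (block_of j))"
    unfolding block_of_def by (rule LeastI_ex)
  moreover have "block_start (block_of j) \<le> j"
  proof (cases "block_of j")
    case 0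
    then show ?thesis by (simp add: block_start_def)
  next
    case (Suc k)
    then have "\<not> j < block_start (Suc k)"
      unfolding block_of_def by (metis lessI not_less_Least)
    then show ?thesis using Suc by simp
  qed
  ultimately show ?thesis by (simp add: block_def)
qed

lemma less_block_start_iff: "n < block_start k \<longleftrightarrow> block_of n < k"
proof
  assume "n < block_start k"
  moreover have "block_start (block_of n) \<le> n"
    using in_block_of[of n] by (simp add: block_def)
  ultimately show "block_of n < k"
    using block_start_mono[of k "block_of n"] by (meson leD le_less_trans not_le_imp_less)
next
  assume "block_of n < k"
  then have "block_start (Suc (block_of n)) \<le> block_start k" by (intro block_start_mono) simp
  then show "n < block_start k" using in_block_of[of n] by (simp add: block_def)
qed

lemma lessThan_block_start_Suc:
  "{..<block_start (Suc m)} = {..<block_start m} \<union> block m" "{..<block_start m} \<inter> block m = {}"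
  by (auto simp: block_def block_start_Suc)

lemma weight_pos: "0 < weight j"
  by (simp add: weight_def)

lemma sum_weight_block: "(\<Sum>j\<in>block m. weight j) = (1/4) ^ m"
proof -
  have "(\<Sum>j\<in>block m. weight j) = (\<Sum>j\<in>block m. (1/2) ^ (block_bits m + 2 * m))"
    by (intro sum.cong) (simp_all add: weight_def depth_def block_of_eq)
  also have "\<dots> = 2 ^ block_bits m * (1/2) ^ block_bits m * ((1/2)\<^sup>2) ^ m"
    by (simp add: card_block power_add power_mult)
  also have "\<dots> = (1/4) ^ m"
    unfolding power_mult_distrib[symmetric] by (simp add: power2_eq_square)
  finally show ?thesis .
qed

lemma summable_weight: "summable weight"
proof (rule summableI_nonneg_bounded)
  fix n
  have "(\<Sum>j<n. weight j) \<le> (\<Sum>j<block_start n. weight j)"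
    using le_block_start[of n] weight_pos by (intro sum_mono2) (auto simp: less_imp_le)
  also have "\<dots> = (\<Sum>m<n. (1/4) ^ m)"
  proof (induction n)
    case 0
    then show ?case by (simp add: block_start_def)
  next
    case (Suc n)
    then show ?case
      by (simp add: lessThan_block_start_Suc sum.union_disjoint finite_block sum_weight_block)
  qed
  also have "\<dots> \<le> (\<Sum>m. (1/4) ^ m)"
    by (rule sum_le_suminf) (auto simp: summable_geometric)
  finally show "(\<Sum>j<n. weight j) \<le> (\<Sum>m. (1/4) ^ m)" .
qed (use weight_pos in \<open>simp add: less_imp_le\<close>)

lemma dilation_bounds: "1 / 2 \<le> dilation j" "dilation j < 1"
proof -
  have "(1/2::real) ^ depth j \<le> 1" by (rule power_le_one) auto
  then show "1 / 2 \<le> dilation j" by (simp add: dilation_def)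
qed (simp add: dilation_def)

lemma norm_dilation_less_1:
  fixes z :: complex
  assumes "norm z \<le> 1" shows "norm (of_real (dilation j) * z) < 1"
proof -
  have "dilation j * norm z \<le> dilation j * 1"
    using assms dilation_bounds(1)[of j] by (intro mult_left_mono) auto
  also have "\<dots> < 1"
    using dilation_bounds(2)[of j] by simp
  finally show ?thesis
    using dilation_bounds(1)[of j] by (simp add: norm_mult)
qed

section \<open>The one-variable factors\<close>

definition poisson :: "nat \<Rightarrow> complex \<Rightarrow> real" where
  "poisson j z = Re (herglotz (of_real (dilation j) * z))"

definition factor :: "nat \<Rightarrow> complex \<Rightarrow> complex" where
  "factor j z = exp (- of_real (weight j) * herglotz (of_real (dilation j) * z))"

lemma poisson_nonneg: "norm z \<le> 1 \<Longrightarrow> 0 \<le> poisson j z"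
  unfolding poisson_def by (intro Re_herglotz_nonneg norm_dilation_less_1)

lemma poisson_0: "poisson j 0 = 1"
  by (simp add: poisson_def herglotz_def)

lemma norm_factor: "norm (factor j z) = exp (- weight j * poisson j z)"
  by (simp add: factor_def poisson_def)

lemma norm_factor_le_1: "norm z \<le> 1 \<Longrightarrow> norm (factor j z) \<le> 1"
  unfolding norm_factor using poisson_nonneg[of z j] weight_pos[of j] by simp

lemma factor_0: "factor j 0 = of_real (exp (- weight j))"
  by (simp add: factor_def herglotz_def exp_of_real[symmetric])

lemma herglotz_dilation_holomorphic:
  "(\<lambda>z. herglotz (of_real (dilation j) * z)) holomorphic_on ball 0 (1 / dilation j)"
proof -
  have "(herglotz \<circ> (\<lambda>z. of_real (dilation j) * z)) holomorphic_on ball 0 (1 / dilation j)"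
  proof (rule holomorphic_on_compose_gen[OF _ herglotz_holomorphic])
    show "(\<lambda>z::complex. of_real (dilation j) * z) ` ball 0 (1 / dilation j) \<subseteq> ball 0 1"
      using dilation_bounds[of j] by (auto simp: norm_mult field_simps)
  qed (intro holomorphic_intros)
  then show ?thesis by (simp add: o_def)
qed

lemma factor_holomorphic: "factor j holomorphic_on ball 0 (1 / dilation j)"
  unfolding factor_def[abs_def] by (intro holomorphic_intros herglotz_dilation_holomorphic)

lemma one_less_inverse_dilation: "1 < 1 / dilation j"
  using dilation_bounds[of j] by simp

lemma continuous_on_circle_if_holomorphic:
  assumes "g holomorphic_on ball 0 R" "1 < R" shows "continuous_on (sphere 0 1) g"
  by (rule continuous_on_subset[OF holomorphic_on_imp_continuous_on[OF assms(1)]])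
     (use assms(2) in auto)

lemmas continuous_on_factor =
  continuous_on_circle_if_holomorphic[OF factor_holomorphic one_less_inverse_dilation]

lemma continuous_on_poisson: "continuous_on (sphere 0 1) (poisson j)"
  unfolding poisson_def[abs_def]
  by (intro continuous_intros
      continuous_on_circle_if_holomorphic[OF herglotz_dilation_holomorphic one_less_inverse_dilation])

text \<open>
  The mean value property of the harmonic function \<open>Re h(s\<^sub>j z)\<close>.
\<close>
lemma poisson_mean: "(LINT z|circle_measure. poisson j z) = 1"
proof -
  let ?h = "\<lambda>z. herglotz (of_real (dilation j) * z)"
  note hol = herglotz_dilation_holomorphic[of j] one_less_inverse_dilation[of j]
  have "integrable circle_measure ?h"
    by (intro integrable_circle continuous_on_circle_if_holomorphic[OF hol])
  then have "(LINT z|circle_measure. Re (?h z)) = Re (LINT z|circle_measure. ?h z)"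
    by (rule integral_Re)
  also have "\<dots> = 1"
    unfolding circle_mean_value[OF hol] by (simp add: herglotz_def)
  finally show ?thesis by (simp add: poisson_def)
qed

section \<open>The boundary function\<close>

definition partial_product :: "nat \<Rightarrow> (nat \<Rightarrow> complex) \<Rightarrow> complex" where
  "partial_product n w = (\<Prod>j<n. factor j (w j))"

definition block_product :: "nat \<Rightarrow> (nat \<Rightarrow> complex) \<Rightarrow> complex" where
  "block_product m w = (\<Prod>j\<in>block m. factor j (w j))"

text \<open>
  The limit is taken along the block ends: almost everywhere convergence follows from a summable
  sequence of \<open>L\<^sup>1\<close> norms, and grouping the variables into blocks makes these norms summable.
\<close>
definition infinite_product :: "(nat \<Rightarrow> complex) \<Rightarrow> complex" where
  "infinite_product w = lim (\<lambda>m. partial_product (block_start m) w)"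

lemma partial_product_block_start_Suc:
  "partial_product (block_start (Suc m)) w = partial_product (block_start m) w * block_product m w"
  unfolding partial_product_def block_product_def lessThan_block_start_Suc(1)
  using lessThan_block_start_Suc(2)[of m] finite_block by (subst prod.union_disjoint) auto

lemma norm_partial_product:
  "norm (partial_product n w) = exp (- (\<Sum>j<n. weight j * poisson j (w j)))"
  unfolding partial_product_def prod_norm[symmetric] norm_factor
  by (simp add: exp_sum sum_negf[symmetric])

lemma norm_partial_product_le_1:
  "(\<And>n. norm (w n) \<le> 1) \<Longrightarrow> norm (partial_product n w) \<le> 1"
  unfolding partial_product_def prod_norm[symmetric] by (intro prod_le_1) (auto simp: norm_factor_le_1)

lemma norm_block_product_le_1:
  "(\<And>n. norm (w n) \<le> 1) \<Longrightarrow> norm (block_product m w) \<le> 1"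
  unfolding block_product_def prod_norm[symmetric] by (intro prod_le_1) (auto simp: norm_factor_le_1)

lemma borel_measurable_partial_product[measurable]: "partial_product n \<in> borel_measurable torus"
  unfolding partial_product_def[abs_def]
  by (intro borel_measurable_prod borel_measurable_torus_component borel_measurable_circle
      continuous_on_factor)

lemma integrable_block_product: "integrable torus (block_product m)"
  and block_product_mean: "(LINT w|torus. block_product m w) = of_real (exp (- ((1/4) ^ m)))"
proof -
  have int: "integrable circle_measure (factor j)" for j
    by (rule integrable_circle[OF continuous_on_factor])
  show "integrable torus (block_product m)"
    unfolding block_product_def[abs_def] by (rule integrable_torus_prod[OF finite_block int])
  have "(LINT w|torus. block_product m w) = (\<Prod>j\<in>block m. of_real (exp (- weight j)))"
    unfolding block_product_def
    by (simp add: integral_torus_prod[OF finite_block int]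
        circle_mean_value[OF factor_holomorphic one_less_inverse_dilation] factor_0)
  also have "\<dots> = of_real (exp (- (\<Sum>j\<in>block m. weight j)))"
    by (simp add: exp_sum[OF finite_block] sum_negf[symmetric])
  finally show "(LINT w|torus. block_product m w) = of_real (exp (- ((1/4) ^ m)))"
    by (simp add: sum_weight_block)
qed

text \<open>
  From \<open>|g - 1|\<^sup>2 \<le> 2 - 2 Re g\<close> and \<open>2 |g - 1| \<le> l |g - 1|\<^sup>2 + 1 / l\<close>. The bound is linear in \<open>g\<close>, so it can be
  integrated when only the mean of \<open>g\<close> is known; the parameter \<open>l\<close> replaces the use of the
  Cauchy--Schwarz inequality.
\<close>
lemma norm_minus_1_le:
  fixes g :: complex
  assumes g: "norm g \<le> 1" and l: "0 < l"
  shows "norm (g - 1) \<le> l * (1 - Re g) + 1 / (2 * l)"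
proof -
  let ?x = "norm (g - 1)"
  have "?x\<^sup>2 = (norm g)\<^sup>2 + 1 - 2 * Re g"
    unfolding cmod_power2 by (simp add: power2_eq_square algebra_simps)
  then have x: "?x\<^sup>2 \<le> 2 - 2 * Re g"
    using g power_le_one[of "norm g" 2] by simp
  have "0 \<le> (l * ?x - 1)\<^sup>2" by simp
  then have "2 * l * ?x \<le> l * l * ?x\<^sup>2 + 1"
    by (simp add: power2_eq_square algebra_simps)
  also have "\<dots> \<le> l * l * (2 - 2 * Re g) + 1"
    using x by (intro add_right_mono mult_left_mono) auto
  finally show ?thesis
    using l by (simp add: field_simps)
qed

text \<open>
  The choice \<open>l = 2\<^sup>m\<close> balances the two terms of \<open>norm_minus_1_le\<close>, since \<open>1 - Re g\<close> has mean at most \<open>4\<^sup>-\<^sup>m\<close>.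
\<close>
lemma block_product_L1: "(LINT w|torus. norm (block_product m w - 1)) \<le> 3 / 2 * (1/2) ^ m"
proof -
  note int = integrable_block_product[of m]
  have "(LINT w|torus. norm (block_product m w - 1)) \<le>
      (LINT w|torus. 2 ^ m * (1 - Re (block_product m w)) + 1 / (2 * 2 ^ m))"
  proof (rule integral_mono_AE)
    show "integrable torus (\<lambda>w. norm (block_product m w - 1))"
      using int by (intro integrable_norm Bochner_Integration.integrable_diff) auto
    show "integrable torus (\<lambda>w. 2 ^ m * (1 - Re (block_product m w)) + 1 / (2 * 2 ^ m))"
      using int by auto
    show "AE w in torus. norm (block_product m w - 1) \<le>
        2 ^ m * (1 - Re (block_product m w)) + 1 / (2 * 2 ^ m)"
      using AE_torus_unimodular
    proof eventually_elim
      fix w :: "nat \<Rightarrow> complex" assume "\<forall>n. norm (w n) = 1"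
      then show "norm (block_product m w - 1) \<le>
        2 ^ m * (1 - Re (block_product m w)) + 1 / (2 * 2 ^ m)"
        by (intro norm_minus_1_le norm_block_product_le_1) auto
    qed
  qed
  also have "\<dots> = 2 ^ m * (1 - exp (- ((1/4) ^ m))) + 1 / (2 * 2 ^ m)"
    using int torus.prob_space by (simp add: integral_Re block_product_mean)
  also have "\<dots> \<le> 2 ^ m * (1/4) ^ m + 1 / (2 * 2 ^ m)"
    using exp_ge_add_one_self[of "- ((1/4) ^ m)"] by (intro add_right_mono mult_left_mono) auto
  also have "\<dots> = 3 / 2 * (1/2) ^ m"
    by (simp add: power_mult_distrib[symmetric] power_one_over[symmetric])
  finally show ?thesis .
qed

text \<open>
  All partial products lie in the closed unit disc, so consecutive ones at block ends differ by at most
  \<open>|G - 1|\<close> for the block product \<open>G\<close>, and these differences are almost everywhere summable.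
\<close>
lemma AE_partial_product_tendsto:
  "AE w in torus. (\<lambda>m. partial_product (block_start m) w) \<longlonglongrightarrow> infinite_product w"
proof -
  have "AE w in torus. summable (\<lambda>m. norm (block_product m w - 1))"
  proof (rule AE_summable_of_summable_integrals)
    show "integrable torus (\<lambda>w. norm (block_product m w - 1))" for m
      using integrable_block_product by (intro integrable_norm Bochner_Integration.integrable_diff) auto
    show "summable (\<lambda>m. LINT w|torus. norm (block_product m w - 1))"
      by (rule summable_comparison_test'[where N = 0 and g = "\<lambda>m. 3 / 2 * (1/2) ^ m"])
         (use block_product_L1 in \<open>auto intro!: summable_mult summable_geometric simp: abs_of_nonneg\<close>)
  qed auto
  with AE_torus_unimodular show ?thesis
  proof eventually_elim
    fix w :: "nat \<Rightarrow> complex" assume w: "\<forall>n. norm (w n) = 1" and sum: "summable (\<lambda>m. norm (block_product m w - 1))"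
    let ?p = "\<lambda>m. partial_product (block_start m) w"
    have "norm (?p (Suc m) - ?p m) \<le> norm (block_product m w - 1)" for m
    proof -
      have "?p (Suc m) - ?p m = ?p m * (block_product m w - 1)"
        by (simp add: partial_product_block_start_Suc algebra_simps)
      then show ?thesis
        using norm_partial_product_le_1[of w "block_start m"] w
        by (simp add: norm_mult mult_left_le_one_le)
    qed
    then have "summable (\<lambda>m. ?p (Suc m) - ?p m)"
      by (intro summable_comparison_test'[OF sum]) auto
    then have "convergent (\<lambda>n. \<Sum>m<n. ?p (Suc m) - ?p m)"
      by (simp add: summable_iff_convergent)
    then have "convergent (\<lambda>n. ?p n - ?p 0)"
      unfolding sum_lessThan_telescope[of ?p] .
    then have "convergent ?p"
      by (simp add: convergent_diff_const_right_iff)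
    then show "?p \<longlonglongrightarrow> infinite_product w"
      unfolding infinite_product_def by (simp add: convergent_LIMSEQ_iff)
  qed
qed

lemma AE_poisson_summable: "AE w in torus. summable (\<lambda>j. weight j * poisson j (w j))"
proof (rule AE_summable_of_summable_integrals)
  have int: "integrable circle_measure (poisson j)" for j
    by (rule integrable_circle[OF continuous_on_poisson])
  show "integrable torus (\<lambda>w. weight j * poisson j (w j))" for j
    using integrable_torus_prod[of "{j}" poisson] int by simp
  show "AE w in torus. 0 \<le> weight j * poisson j (w j)" for j
    using AE_torus_unimodular
    by eventually_elim (auto intro!: mult_nonneg_nonneg poisson_nonneg simp: weight_pos less_imp_le)
  have "(LINT w|torus. weight j * poisson j (w j)) = weight j" for j
    using integral_torus_prod[of "{j}" poisson] int by (simp add: poisson_mean)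
  then show "summable (\<lambda>j. LINT w|torus. weight j * poisson j (w j))"
    using summable_weight by (simp only:)
qed

text \<open>
  The moduli of the partial products are bounded below by \<open>exp (- S)\<close>, where \<open>S\<close> is the almost everywhere
  finite sum of all weighted Poisson kernels.
\<close>
lemma AE_infinite_product_nonzero: "AE w in torus. infinite_product w \<noteq> 0"
  using AE_torus_unimodular AE_partial_product_tendsto AE_poisson_summable
proof eventually_elim
  fix w :: "nat \<Rightarrow> complex"
  assume w: "\<forall>n. norm (w n) = 1"
    and lim: "(\<lambda>m. partial_product (block_start m) w) \<longlonglongrightarrow> infinite_product w"
    and sum: "summable (\<lambda>j. weight j * poisson j (w j))"
  have "exp (- (\<Sum>j. weight j * poisson j (w j))) \<le> norm (partial_product n w)" for n
    unfolding norm_partial_product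
    using w weight_pos by (auto intro!: sum_le_suminf[OF sum] mult_nonneg_nonneg poisson_nonneg simp: less_imp_le)
  then have "exp (- (\<Sum>j. weight j * poisson j (w j))) \<le> norm (infinite_product w)"
    by (intro tendsto_lowerbound[OF tendsto_norm[OF lim]]) auto
  then show "infinite_product w \<noteq> 0"
    using exp_gt_zero[of "- (\<Sum>j. weight j * poisson j (w j))"] by auto
qed

lemma infinite_product_Linf: "infinite_product \<in> Linf_torus"
proof -
  have "infinite_product \<in> borel_measurable torus"
    unfolding infinite_product_def[abs_def] by measurable
  moreover have "AE w in torus. norm (infinite_product w) \<le> 1"
    using AE_torus_unimodular AE_partial_product_tendsto
  proof eventually_elim
    fix w :: "nat \<Rightarrow> complex"
    assume "\<forall>n. norm (w n) = 1"
      and lim: "(\<lambda>m. partial_product (block_start m) w) \<longlonglongrightarrow> infinite_product w"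
    then show "norm (infinite_product w) \<le> 1"
      by (intro tendsto_upperbound[OF tendsto_norm[OF lim]]) (auto intro!: always_eventually norm_partial_product_le_1)
  qed
  ultimately show ?thesis unfolding Linf_torus_def by blast
qed

section \<open>Fourier coefficients of the boundary function\<close>

lemma character_measurable:
  "finite {n. \<nu> n \<noteq> (0::int)} \<Longrightarrow> (\<lambda>w. \<Prod>n | \<nu> n \<noteq> 0. w n powi \<nu> n) \<in> borel_measurable torus"
  by (intro borel_measurable_prod borel_measurable_torus_component borel_measurable_circle continuous_intros)
     auto

lemma integral_partial_product_character:
  assumes supp: "{j. \<nu> j \<noteq> (0::int)} \<subseteq> {..<n}"
  shows "(LINT w|torus. partial_product n w * cnj (\<Prod>j | \<nu> j \<noteq> 0. w j powi \<nu> j)) =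
    (\<Prod>j<n. if 0 \<le> \<nu> j then taylor_coeff (factor j) (nat (\<nu> j)) else 0)"
proof -
  have "partial_product n w * cnj (\<Prod>j | \<nu> j \<noteq> 0. w j powi \<nu> j) =
      (\<Prod>j<n. factor j (w j) * cnj (w j powi \<nu> j))" for w
  proof -
    have "(\<Prod>j | \<nu> j \<noteq> 0. w j powi \<nu> j) = (\<Prod>j<n. w j powi \<nu> j)"
      using supp by (intro prod.mono_neutral_left) auto
    then show ?thesis
      by (simp add: partial_product_def prod.distrib)
  qed
  moreover
  have "integrable circle_measure (\<lambda>z. factor j z * cnj (z powi \<nu> j))" for j
    by (intro integrable_circle continuous_intros continuous_on_factor) auto
  then have "(LINT w|torus. (\<Prod>j<n. factor j (w j) * cnj (w j powi \<nu> j))) =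
      (\<Prod>j<n. LINT z|circle_measure. factor j z * cnj (z powi \<nu> j))"
    by (intro integral_torus_prod) auto
  ultimately show ?thesis
    by (simp only: circle_fourier_holomorphic[OF factor_holomorphic one_less_inverse_dilation])
qed

text \<open>
  Dominated convergence: all partial products and characters are bounded by 1.
\<close>
lemma fourier_coeff_infinite_product_limit:
  assumes supp: "{j. \<nu> j \<noteq> (0::int)} \<subseteq> {..<n}"
  shows "(\<lambda>m. \<Prod>j<block_start m. if 0 \<le> \<nu> j then taylor_coeff (factor j) (nat (\<nu> j)) else 0)
    \<longlonglongrightarrow> fourier_coeff infinite_product \<nu>"
proof -
  let ?\<chi> = "\<lambda>w :: nat \<Rightarrow> complex. \<Prod>j | \<nu> j \<noteq> 0. w j powi \<nu> j"
  have fin: "finite {j. \<nu> j \<noteq> 0}" using supp by (rule finite_subset) simp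
  note character_measurable[OF fin, measurable]
  have [measurable]: "cnj \<in> borel_measurable borel"
    by (intro borel_measurable_continuous_onI continuous_intros)
  have [measurable]: "infinite_product \<in> borel_measurable torus"
    using infinite_product_Linf by (simp add: Linf_torus_def)
  have "(\<lambda>m. LINT w|torus. partial_product (block_start m) w * cnj (?\<chi> w))
      \<longlonglongrightarrow> (LINT w|torus. infinite_product w * cnj (?\<chi> w))"
  proof (rule integral_dominated_convergence[where w = "\<lambda>_. 1"])
    show "(\<lambda>w. infinite_product w * cnj (?\<chi> w)) \<in> borel_measurable torus" by measurable
    show "(\<lambda>w. partial_product (block_start m) w * cnj (?\<chi> w)) \<in> borel_measurable torus" for m by measurable
    show "AE w in torus. (\<lambda>m. partial_product (block_start m) w * cnj (?\<chi> w)) \<longlonglongrightarrow>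
        infinite_product w * cnj (?\<chi> w)"
      using AE_partial_product_tendsto by eventually_elim (intro tendsto_mult_right)
    show "AE w in torus. norm (partial_product (block_start m) w * cnj (?\<chi> w)) \<le> 1" for m
      using AE_torus_unimodular
      by eventually_elim
         (simp add: norm_mult prod_norm[symmetric] norm_power_int norm_partial_product_le_1)
  qed simp
  then show ?thesis
    unfolding fourier_coeff_def
  proof (rule Lim_transform_eventually)
    show "\<forall>\<^sub>F m in sequentially. (LINT w|torus. partial_product (block_start m) w * cnj (?\<chi> w)) =
       (\<Prod>j<block_start m. if 0 \<le> \<nu> j then taylor_coeff (factor j) (nat (\<nu> j)) else 0)"
      using eventually_ge_at_top[of n]
    proof eventually_elim
      fix m assume "n \<le> m"
      then have "{..<n} \<subseteq> {..<block_start m}"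
        using le_block_start[of m] by auto
      then show "(LINT w|torus. partial_product (block_start m) w * cnj (?\<chi> w)) =
       (\<Prod>j<block_start m. if 0 \<le> \<nu> j then taylor_coeff (factor j) (nat (\<nu> j)) else 0)"
        by (rule integral_partial_product_character[OF order_trans[OF supp]])
    qed
  qed
qed

text \<open>
  A negative exponent in a single coordinate annihilates the corresponding factor of the product, because the
  factors are holomorphic.
\<close>
lemma infinite_product_Hinf: "infinite_product \<in> Hinf_torus"
  unfolding Hinf_torus_def
proof (intro CollectI conjI infinite_product_Linf allI impI)
  fix \<nu> :: "nat \<Rightarrow> int"
  assume "finite {n. \<nu> n \<noteq> 0}" and neg: "\<not> (\<forall>n. 0 \<le> \<nu> n)"
  then obtain n where supp: "{j. \<nu> j \<noteq> 0} \<subseteq> {..<n}"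
    using finite_nat_iff_bounded by metis
  from neg obtain i where i: "\<nu> i < 0" by (auto simp: not_le)
  have "\<forall>\<^sub>F m in sequentially.
      (\<Prod>j<block_start m. if 0 \<le> \<nu> j then taylor_coeff (factor j) (nat (\<nu> j)) else 0) = 0"
    using eventually_gt_at_top[of i]
  proof eventually_elim
    fix m assume "i < m"
    then have "i \<in> {..<block_start m}" using le_block_start[of m] by simp
    then show "(\<Prod>j<block_start m. if 0 \<le> \<nu> j then taylor_coeff (factor j) (nat (\<nu> j)) else 0) = 0"
      using i by (intro prod_zero bexI[of _ i]) auto
  qed
  then have "(\<lambda>m. \<Prod>j<block_start m. if 0 \<le> \<nu> j then taylor_coeff (factor j) (nat (\<nu> j)) else 0)
    \<longlonglongrightarrow> 0"
    by (rule tendsto_eventually)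
  then show "fourier_coeff infinite_product \<nu> = 0"
    using fourier_coeff_infinite_product_limit[OF supp] LIMSEQ_unique by blast
qed

section \<open>Point evaluations\<close>

definition weight_tail :: "nat \<Rightarrow> real" where
  "weight_tail n = suminf weight - (\<Sum>j<n. weight j)"

lemma weight_tail_tendsto: "weight_tail \<longlonglongrightarrow> 0"
proof -
  have "(\<lambda>n. suminf weight - (\<Sum>j<n. weight j)) \<longlonglongrightarrow> suminf weight - suminf weight"
    by (rule tendsto_diff[OF tendsto_const summable_LIMSEQ[OF summable_weight]])
  then show ?thesis
    by (simp only: weight_tail_def[abs_def] diff_self)
qed

text \<open>
  Every coordinate beyond \<open>n\<close> contributes the constant Taylor coefficient \<open>exp (- \<epsilon>\<^sub>j)\<close> of its factor.
\<close>
lemma fourier_coeff_infinite_product: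
  assumes \<mu>: "\<And>j. n \<le> j \<Longrightarrow> \<mu> j = 0"
  shows "fourier_coeff infinite_product (\<lambda>j. int (\<mu> j)) =
    of_real (exp (- weight_tail n)) * (\<Prod>j<n. taylor_coeff (factor j) (\<mu> j))"
proof (rule LIMSEQ_unique)
  let ?c = "\<lambda>j. taylor_coeff (factor j) (\<mu> j)"
  have supp: "{j. int (\<mu> j) \<noteq> 0} \<subseteq> {..<n}"
  proof
    fix j assume "j \<in> {j. int (\<mu> j) \<noteq> 0}"
    then show "j \<in> {..<n}" using \<mu>[of j] by (cases "n \<le> j") auto
  qed
  show "(\<lambda>m. \<Prod>j<block_start m. ?c j) \<longlonglongrightarrow> fourier_coeff infinite_product (\<lambda>j. int (\<mu> j))"
    using fourier_coeff_infinite_product_limit[OF supp] by simp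
  have "(\<lambda>m. of_real (exp (- ((\<Sum>j<block_start m. weight j) - (\<Sum>j<n. weight j)))) * (\<Prod>j<n. ?c j))
      \<longlonglongrightarrow> of_real (exp (- weight_tail n)) * (\<Prod>j<n. ?c j)"
    unfolding weight_tail_def
    by (intro tendsto_intros LIMSEQ_subseq_LIMSEQ[OF summable_LIMSEQ[OF summable_weight] 
          strict_mono_block_start, unfolded o_def])
  then show "(\<lambda>m. \<Prod>j<block_start m. ?c j) \<longlonglongrightarrow> of_real (exp (- weight_tail n)) * (\<Prod>j<n. ?c j)"
  proof (rule Lim_transform_eventually)
    show "\<forall>\<^sub>F m in sequentially.
      of_real (exp (- ((\<Sum>j<block_start m. weight j) - (\<Sum>j<n. weight j)))) * (\<Prod>j<n. ?c j)
      = (\<Prod>j<block_start m. ?c j)"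
      using eventually_ge_at_top[of n]
    proof eventually_elim
      fix m assume "n \<le> m"
      then have split: "{..<block_start m} = {..<n} \<union> {n..<block_start m}"
        using le_block_start[of m] by auto
      have "(\<Prod>j\<in>{n..<block_start m}. ?c j) = (\<Prod>j\<in>{n..<block_start m}. of_real (exp (- weight j)))"
        using \<mu> by (intro prod.cong) (auto simp: taylor_coeff_0 factor_0)
      also have "\<dots> = of_real (exp (- (\<Sum>j\<in>{n..<block_start m}. weight j)))"
        by (simp add: exp_sum sum_negf[symmetric])
      also have "(\<Sum>j\<in>{n..<block_start m}. weight j) = (\<Sum>j<block_start m. weight j) - (\<Sum>j<n. weight j)"
        unfolding split by (subst sum.union_disjoint) auto
      finally have *: "(\<Prod>j\<in>{n..<block_start m}. ?c j) =
        of_real (exp (- ((\<Sum>j<block_start m. weight j) - (\<Sum>j<n. weight j))))" .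
      have "(\<Prod>j<block_start m. ?c j) = (\<Prod>j<n. ?c j) * (\<Prod>j\<in>{n..<block_start m}. ?c j)"
        unfolding split by (rule prod.union_disjoint) auto
      then show "of_real (exp (- ((\<Sum>j<block_start m. weight j) - (\<Sum>j<n. weight j)))) * (\<Prod>j<n. ?c j)
        = (\<Prod>j<block_start m. ?c j)"
        unfolding * by (simp add: mult.commute)
    qed
  qed
qed

text \<open>
  By the product form of the Fourier coefficients the multiple power series factorizes into the
  Taylor series of the individual factors. The remaining factors are evaluated at 0.
\<close>
lemma abschnitt_infinite_product:
  assumes z: "\<And>j. norm (z j) \<le> 1"
  shows "abschnitt n infinite_product z = of_real (exp (- weight_tail n)) * (\<Prod>j<n. factor j (z j))"
proof -
  let ?t = "\<lambda>j k. taylor_coeff (factor j) k * z j ^ k"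
  let ?N = "{\<nu> :: nat \<Rightarrow> nat. \<forall>j\<ge>n. \<nu> j = 0}"
  have bij: "bij_betw (\<lambda>\<nu>. restrict \<nu> {..<n}) ?N ({..<n} \<rightarrow>\<^sub>E (UNIV :: nat set))"
  proof (rule bij_betw_byWitness[where f' = "\<lambda>\<mu> j. if j < n then \<mu> j else 0"])
    show "\<forall>\<nu>\<in>?N. (\<lambda>j. if j < n then restrict \<nu> {..<n} j else 0) = \<nu>"
      by (auto simp: fun_eq_iff)
    show "\<forall>\<mu>\<in>{..<n} \<rightarrow>\<^sub>E (UNIV :: nat set). restrict (\<lambda>j. if j < n then \<mu> j else 0) {..<n} = \<mu>"
    proof (intro ballI ext)
      fix \<mu> :: "nat \<Rightarrow> nat" and j assume "\<mu> \<in> {..<n} \<rightarrow>\<^sub>E (UNIV :: nat set)"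
      then show "restrict (\<lambda>j. if j < n then \<mu> j else 0) {..<n} j = \<mu> j"
        using PiE_arb[of \<mu> "{..<n}" "\<lambda>_. UNIV" j] by (cases "j < n") simp_all
    qed
    show "(\<lambda>\<nu>. restrict \<nu> {..<n}) ` ?N \<subseteq> {..<n} \<rightarrow>\<^sub>E (UNIV :: nat set)"
      by (intro image_subsetI) simp
    show "(\<lambda>\<mu> j. if j < n then \<mu> j else 0) ` ({..<n} \<rightarrow>\<^sub>E (UNIV :: nat set)) \<subseteq> ?N"
      by (intro image_subsetI) simp
  qed
  have "abschnitt n infinite_product z =
      (\<Sum>\<^sub>\<infinity>\<nu>\<in>?N. of_real (exp (- weight_tail n)) * (\<Prod>j<n. ?t j (restrict \<nu> {..<n} j)))"
    unfolding abschnitt_def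
    by (rule infsum_cong) (simp add: fourier_coeff_infinite_product prod.distrib)
  also have "\<dots> = of_real (exp (- weight_tail n)) * (\<Sum>\<^sub>\<infinity>\<nu>\<in>?N. \<Prod>j<n. ?t j (restrict \<nu> {..<n} j))"
    by (rule infsum_cmult_right')
  also have "(\<Sum>\<^sub>\<infinity>\<nu>\<in>?N. \<Prod>j<n. ?t j (restrict \<nu> {..<n} j)) =
      (\<Sum>\<^sub>\<infinity>\<mu>\<in>{..<n} \<rightarrow>\<^sub>E UNIV. \<Prod>j<n. ?t j (\<mu> j))"
    by (rule infsum_reindex_bij_betw[OF bij])
  also have "\<dots> = (\<Prod>j<n. \<Sum>\<^sub>\<infinity>k. ?t j k)"
  proof (rule infsum_prod_PiE_abs)
    show "(\<lambda>k. norm (?t j k)) summable_on UNIV" for j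
      using taylor_series(2)[OF factor_holomorphic one_less_inverse_dilation z]
      by (intro norm_summable_imp_summable_on) simp
  qed simp
  also have "\<dots> = (\<Prod>j<n. factor j (z j))"
  proof (rule prod.cong[OF refl], rule infsumI)
    fix j
    show "(?t j has_sum factor j (z j)) UNIV"
      using taylor_series[OF factor_holomorphic one_less_inverse_dilation z]
      by (rule norm_summable_imp_has_sum[rotated])
  qed
  finally show ?thesis .
qed

text \<open>
  Since \<open>z\<^sub>j \<longlonglongrightarrow> 0\<close>, the values \<open>h(s\<^sub>j z\<^sub>j)\<close> are eventually bounded by 3, and the weights are summable.
\<close>
lemma
  assumes z: "z \<in> polydisc_c0"
  shows summable_poisson: "summable (\<lambda>j. weight j * poisson j (z j))"
    and norm_point_eval: "norm (point_eval infinite_product z) = exp (- (\<Sum>j. weight j * poisson j (z j)))"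
proof -
  let ?h = "\<lambda>j. of_real (weight j) * herglotz (of_real (dilation j) * z j)"
  from z have z1: "norm (z j) \<le> 1" for j by (simp add: polydisc_c0_def less_imp_le)
  from z have "z \<longlonglongrightarrow> 0" by (simp add: polydisc_c0_def)
  then have "\<forall>\<^sub>F j in sequentially. norm (z j) < 1 / 2"
    using tendsto_norm_zero order_tendstoD(2) by (metis half_gt_zero zero_less_one)
  then have "\<forall>\<^sub>F j in sequentially. norm (?h j) \<le> 3 * weight j"
  proof eventually_elim
    fix j assume j: "norm (z j) < 1 / 2"
    have "norm (of_real (dilation j) * z j) \<le> 1 * norm (z j)"
      unfolding norm_mult using dilation_bounds[of j] by (intro mult_right_mono) auto
    then have "norm (herglotz (of_real (dilation j) * z j)) \<le> 3"
      using j by (intro norm_herglotz_le) simp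
    then show "norm (?h j) \<le> 3 * weight j"
      using weight_pos[of j] by (simp add: norm_mult)
  qed
  then have sum: "summable ?h"
    by (rule summable_comparison_test_ev) (intro summable_mult summable_weight)
  have re: "Re (?h j) = weight j * poisson j (z j)" for j
    by (simp add: poisson_def)
  show "summable (\<lambda>j. weight j * poisson j (z j))"
    using summable_Re[OF sum] unfolding re .
  have "abschnitt n infinite_product z = exp (- of_real (weight_tail n) - (\<Sum>j<n. ?h j))" for n
  proof -
    have "(\<Prod>j<n. factor j (z j)) = exp (- (\<Sum>j<n. ?h j))"
      by (simp add: factor_def exp_sum[symmetric] sum_negf)
    moreover have "of_real (exp (- weight_tail n)) = exp (- of_real (weight_tail n) :: complex)"
      by (simp add: exp_of_real[symmetric])
    ultimately show ?thesis
      by (simp only: abschnitt_infinite_product[OF z1] exp_add[symmetric] diff_conv_add_uminus)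
  qed
  moreover have "(\<lambda>n. exp (- of_real (weight_tail n) - (\<Sum>j<n. ?h j))) \<longlonglongrightarrow> exp (- of_real 0 - suminf ?h)"
    by (intro tendsto_intros weight_tail_tendsto summable_LIMSEQ sum)
  ultimately have "point_eval infinite_product z = exp (- suminf ?h)"
    unfolding point_eval_def by (simp add: limI)
  moreover have "Re (suminf ?h) = (\<Sum>j. weight j * poisson j (z j))"
    unfolding bounded_linear.suminf[OF bounded_linear_Re sum] re ..
  ultimately show "norm (point_eval infinite_product z) = exp (- (\<Sum>j. weight j * poisson j (z j)))"
    by simp
qed

section \<open>Smallness at well-chosen radii\<close>

text \<open>
  A lower bound for what the variables of block \<open>m\<close> contribute to \<open>- log |f|\<close> at well-chosen radii.
\<close>
definition block_minorant :: "nat \<Rightarrow> (nat \<Rightarrow> complex) \<Rightarrow> real" where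
  "block_minorant m w = (\<Sum>j\<in>block m. weight j * dyadic_minorant (depth j) (w j))"

text \<open>
  The exponent is at least the total weight \<open>4\<^sup>-\<^sup>m\<close> of the block times \<open>128 m 4\<^sup>m / (32 \<pi>)\<close>, which exceeds \<open>m\<close>
  because \<open>\<pi> < 4\<close>.
\<close>
lemma integral_exp_block_minorant: "integrable torus (\<lambda>w. exp (- block_minorant m w))"
  and integral_exp_block_minorant_le: "(LINT w|torus. exp (- block_minorant m w)) \<le> exp (- 1) ^ m"
proof -
  let ?h = "\<lambda>j z. exp (- weight j * dyadic_minorant (depth j) z)"
  note borel_measurable_dyadic_minorant[measurable]
  have int: "integrable circle_measure (?h j)" for j
    using weight_pos[of j] dyadic_minorant_nonneg[of "depth j"]
    by (intro circle.integrable_const_bound[where B = 1] AE_I2) (auto intro: mult_nonneg_nonneg less_imp_le)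
  have prod: "exp (- block_minorant m w) = (\<Prod>j\<in>block m. ?h j (w j))" for w
    unfolding block_minorant_def by (simp add: exp_sum[OF finite_block, symmetric] sum_negf)
  show "integrable torus (\<lambda>w. exp (- block_minorant m w))"
    unfolding prod by (rule integrable_torus_prod[OF finite_block int])
  have "(LINT w|torus. exp (- block_minorant m w)) = (\<Prod>j\<in>block m. LINT z|circle_measure. ?h j z)"
    unfolding prod by (rule integral_torus_prod[OF finite_block int])
  also have "\<dots> \<le> (\<Prod>j\<in>block m. exp (- weight j * (real (Suc (depth j)) / (32 * pi))))"
  proof (intro prod_mono conjI)
    fix j
    show "0 \<le> (LINT z|circle_measure. ?h j z)" by (rule integral_nonneg_AE) simp
    have "weight j * 2 ^ depth j = 1"
      by (simp add: weight_def power_mult_distrib[symmetric])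
    then show "(LINT z|circle_measure. ?h j z) \<le> exp (- weight j * (real (Suc (depth j)) / (32 * pi)))"
      using weight_pos[of j] by (intro dyadic_minorant_laplace) auto
  qed
  also have "\<dots> = exp (- (\<Sum>j\<in>block m. weight j * (real (Suc (depth j)) / (32 * pi))))"
    by (simp add: exp_sum[OF finite_block] sum_negf[symmetric])
  also have "\<dots> \<le> exp (- real m)"
  proof -
    have "real m = (1/4) ^ m * (128 * real m * 4 ^ m / (32 * 4))"
      by (simp add: power_one_over)
    also have "\<dots> \<le> (1/4) ^ m * (real (Suc (block_bits m + 2 * m)) / (32 * pi))"
      using pi_less_4 pi_gt_zero by (intro mult_left_mono frac_le) (auto simp: block_bits_def)
    also have "\<dots> = (\<Sum>j\<in>block m. weight j * (real (Suc (block_bits m + 2 * m)) / (32 * pi)))"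
      by (simp only: sum_distrib_right[symmetric] sum_weight_block)
    also have "\<dots> = (\<Sum>j\<in>block m. weight j * (real (Suc (depth j)) / (32 * pi)))"
      by (intro sum.cong) (simp_all add: depth_def block_of_eq)
    finally show ?thesis by simp
  qed
  also have "\<dots> = exp (- 1) ^ m"
    by (simp add: exp_of_nat_mult[symmetric])
  finally show "(LINT w|torus. exp (- block_minorant m w)) \<le> exp (- 1) ^ m" .
qed

lemma AE_exp_block_minorant_tendsto_0: "AE w in torus. (\<lambda>m. exp (- block_minorant m w)) \<longlonglongrightarrow> 0"
proof -
  have "AE w in torus. summable (\<lambda>m. exp (- block_minorant m w))"
  proof (rule AE_summable_of_summable_integrals[OF integral_exp_block_minorant])
    have "summable (\<lambda>m. exp (- 1 :: real) ^ m)"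
      by (rule summable_geometric) simp
    moreover have "norm (LINT w|torus. exp (- block_minorant m w)) \<le> exp (- 1) ^ m" for m
    proof -
      have "0 \<le> (LINT w|torus. exp (- block_minorant m w))"
        by (rule integral_nonneg_AE) simp
      then show ?thesis using integral_exp_block_minorant_le[of m] by simp
    qed
    ultimately show "summable (\<lambda>m. LINT w|torus. exp (- block_minorant m w))"
      by (rule summable_comparison_test'[where N = 0])
  qed simp
  then show ?thesis
    by eventually_elim (rule summable_LIMSEQ_zero)
qed

text \<open>
  The radius that the dilation turns into \<open>1 - 2\<^sup>-\<^sup>i\<close>. Only the radii with \<open>i\<close> up to the depth are used; that
  there are finitely many of them, the same ones for all boundary points, is what makes an approach independent of the point possible.
\<close>
definition level_radius :: "nat \<Rightarrow> nat \<Rightarrow> real" where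
  "level_radius j i = (1 - (1/2) ^ i) / dilation j"

lemma level_radius_bounds:
  assumes "i \<le> depth j" shows "0 \<le> level_radius j i" "level_radius j i < 1"
proof -
  have "(1/2::real) ^ i \<le> 1" by (rule power_le_one) auto
  then show "0 \<le> level_radius j i"
    using dilation_bounds(1)[of j] by (simp add: level_radius_def)
  have "(1/2::real) ^ Suc (depth j) < (1/2) ^ i"
    using assms by (intro power_strict_decreasing) auto
  then have "1 - (1/2) ^ i < dilation j" by (simp add: dilation_def)
  then show "level_radius j i < 1"
    using dilation_bounds(1)[of j] by (simp add: level_radius_def)
qed

lemma ex_level_radius:
  assumes "norm w = 1"
  shows "\<exists>i\<le>depth j. dyadic_minorant (depth j) w \<le> poisson j (of_real (level_radius j i) * w)"
proof -
  have *: "of_real (dilation j) * (of_real (level_radius j i) * w) = of_real (1 - (1/2) ^ i) * w" for i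
  proof -
    have "dilation j * level_radius j i = 1 - (1/2) ^ i"
      using dilation_bounds(1)[of j] by (simp add: level_radius_def)
    then show ?thesis by (metis mult.assoc of_real_mult)
  qed
  show ?thesis
    unfolding poisson_def * by (rule dyadic_minorant_le_herglotz[OF assms])
qed

section \<open>Radial approaches\<close>

lemma in_polydisc_c0:
  assumes w: "\<forall>n. norm (w n) = 1" and r: "\<And>n. 0 \<le> r n" "\<And>n. r n < 1"
    and fin: "\<And>n. N \<le> n \<Longrightarrow> r n = 0"
  shows "(\<lambda>n. of_real (r n) * w n) \<in> polydisc_c0"
proof -
  have "\<forall>\<^sub>F n in sequentially. of_real (r n) * w n = 0"
    using eventually_ge_at_top[of N] by eventually_elim (simp add: fin)
  then have "(\<lambda>n. of_real (r n) * w n) \<longlonglongrightarrow> 0" by (rule tendsto_eventually)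
  then show ?thesis
    using w r by (simp add: polydisc_c0_def norm_mult)
qed

text \<open>
  A snapshot of an approach at stage \<open>m\<close>: radii \<open>a\<close> on the blocks already treated, radii \<open>\<rho>\<close> on the
  current block, and 0 on all later blocks.
\<close>
definition staged_radii :: "nat \<Rightarrow> (nat \<Rightarrow> real) \<Rightarrow> (nat \<Rightarrow> real) \<Rightarrow> nat \<Rightarrow> real" where
  "staged_radii m a \<rho> n = (if block_of n < m then a n else if block_of n = m then \<rho> n else 0)"

lemma staged_radii_vanish: "block_start (Suc m) \<le> n \<Longrightarrow> staged_radii m a \<rho> n = 0"
  using less_block_start_iff[of n "Suc m"] by (auto simp: staged_radii_def)

text \<open>
  All terms of \<open>- log |f|\<close> are nonnegative, so the current block alone gives the bound, whatever the
  earlier blocks do.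
\<close>
lemma norm_point_eval_staged_le:
  assumes w: "\<forall>n. norm (w n) = 1"
    and a: "\<And>n. 0 \<le> a n" "\<And>n. a n < 1"
    and \<rho>: "\<And>n. n \<in> block m \<Longrightarrow> 0 \<le> \<rho> n" "\<And>n. n \<in> block m \<Longrightarrow> \<rho> n < 1"
    and minorant: "\<And>n. n \<in> block m \<Longrightarrow>
      dyadic_minorant (depth n) (w n) \<le> poisson n (of_real (\<rho> n) * w n)"
  shows "norm (point_eval infinite_product (\<lambda>n. of_real (staged_radii m a \<rho> n) * w n)) \<le> exp (- block_minorant m w)"
proof -
  let ?z = "\<lambda>n. of_real (staged_radii m a \<rho> n) * w n"
  have b: "n \<in> block m" if "block_of n = m" for n
    using in_block_of[of n] that by simp
  have z: "?z \<in> polydisc_c0"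
  proof (rule in_polydisc_c0[OF w])
    show "0 \<le> staged_radii m a \<rho> n" "staged_radii m a \<rho> n < 1" for n
      using a b \<rho> by (auto simp: staged_radii_def)
  qed (rule staged_radii_vanish)
  have nonneg: "0 \<le> weight n * poisson n (?z n)" for n
    using z weight_pos[of n] by (intro mult_nonneg_nonneg poisson_nonneg) (auto simp: polydisc_c0_def less_imp_le)
  have "block_minorant m w \<le> (\<Sum>n\<in>block m. weight n * poisson n (?z n))"
    unfolding block_minorant_def
  proof (rule sum_mono)
    fix n assume n: "n \<in> block m"
    then have "staged_radii m a \<rho> n = \<rho> n" by (simp add: staged_radii_def block_of_eq)
    then show "weight n * dyadic_minorant (depth n) (w n) \<le> weight n * poisson n (?z n)"
      using minorant[OF n] weight_pos[of n] by (intro mult_left_mono) auto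
  qed
  also have "\<dots> \<le> (\<Sum>n. weight n * poisson n (?z n))"
    by (rule sum_le_suminf[OF summable_poisson[OF z] finite_block nonneg])
  finally show ?thesis
    unfolding norm_point_eval[OF z] by simp
qed

definition ramp :: "nat \<Rightarrow> real" where
  "ramp k = 1 - inverse (real (Suc k))"

lemma ramp_bounds: "0 \<le> ramp k" "ramp k < 1"
proof -
  show "0 \<le> ramp k" using inverse_le_1_iff[of "real (Suc k)"] by (simp add: ramp_def)
  show "ramp k < 1" by (simp add: ramp_def)
qed

lemma ramp_mono: "k \<le> l \<Longrightarrow> ramp k \<le> ramp l"
  unfolding ramp_def by (intro diff_left_mono le_imp_inverse_le) auto

lemma ramp_tendsto: "ramp \<longlonglongrightarrow> 1"
  unfolding ramp_def[abs_def]
  using tendsto_diff[OF tendsto_const LIMSEQ_inverse_real_of_nat, of "1::real"] by simp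

text \<open>
  The radius of a variable in block \<open>m\<close> is 0 before stage \<open>m\<close>, equal to its bad value at stage \<open>m\<close>, and the
  maximum of this value and a sequence increasing to 1 afterwards. Hence it is nondecreasing, although at
  each stage some block is at its bad radii.
\<close>
lemma ex_increasing_approach_to_0:
  assumes w: "\<forall>n. norm (w n) = 1" and lim: "(\<lambda>m. exp (- block_minorant m w)) \<longlonglongrightarrow> 0"
  shows "\<exists>r. radial_approach r \<and> (\<forall>n. mono (r n)) \<and>
    (\<lambda>k. norm (point_eval infinite_product (approach_point r w k))) \<longlonglongrightarrow> 0"
proof -
  have "\<exists>i\<le>depth j. dyadic_minorant (depth j) (w j) \<le> poisson j (of_real (level_radius j i) * w j)" for j
    using w by (intro ex_level_radius) simp
  then obtain c where c: "\<And>j. c j \<le> depth j"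
    "\<And>j. dyadic_minorant (depth j) (w j) \<le> poisson j (of_real (level_radius j (c j)) * w j)"
    by metis
  define \<rho> where "\<rho> j = level_radius j (c j)" for j
  have \<rho>: "0 \<le> \<rho> j" "\<rho> j < 1" for j
    using level_radius_bounds[OF c(1)] by (auto simp: \<rho>_def)
  define r where "r n k = staged_radii k (\<lambda>n. max (\<rho> n) (ramp k)) \<rho> n" for n k
  have bounds: "0 \<le> r n k" "r n k < 1" for n k
    using \<rho>[of n] ramp_bounds[of k] by (auto simp: r_def staged_radii_def)
  have "radial_approach r"
    unfolding radial_approach_def
  proof (intro conjI allI bounds)
    fix k
    have "\<forall>\<^sub>F n in sequentially. r n k = 0"
      using eventually_ge_at_top[of "block_start (Suc k)"]
      by eventually_elim (simp add: r_def staged_radii_vanish)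
    then show "(\<lambda>n. r n k) \<longlonglongrightarrow> 0" by (rule tendsto_eventually)
  next
    fix n
    have "(\<lambda>k. max (\<rho> n) (ramp k)) \<longlonglongrightarrow> max (\<rho> n) 1"
      by (intro tendsto_intros ramp_tendsto)
    moreover have "\<forall>\<^sub>F k in sequentially. max (\<rho> n) (ramp k) = r n k"
      using eventually_gt_at_top[of "block_of n"]
      by eventually_elim (simp add: r_def staged_radii_def)
    ultimately show "(\<lambda>k. r n k) \<longlonglongrightarrow> 1"
      using \<rho>(2)[of n] by (simp add: Lim_transform_eventually max_def)
  qed
  moreover have "mono (r n)" for n
  proof (rule monoI)
    fix k l :: nat assume "k \<le> l"
    then show "r n k \<le> r n l"
      using \<rho>[of n] ramp_bounds[of l] ramp_mono[of k l] by (auto simp: r_def staged_radii_def)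
  qed
  moreover have "(\<lambda>k. norm (point_eval infinite_product (approach_point r w k))) \<longlonglongrightarrow> 0"
  proof (rule tendsto_sandwich[OF _ _ tendsto_const lim])
    have "norm (point_eval infinite_product (approach_point r w k)) \<le> exp (- block_minorant k w)" for k
      unfolding approach_point_def r_def
      using \<rho> ramp_bounds[of k] c(2)
      by (intro norm_point_eval_staged_le w) (auto simp: \<rho>_def max_def)
    then show "\<forall>\<^sub>F k in sequentially. norm (point_eval infinite_product (approach_point r w k)) \<le> exp (- block_minorant k w)"
      by (intro always_eventually allI)
  qed simp
  ultimately show ?thesis by blast
qed

text \<open>
  The dilated kernel is continuous up to the circle.
\<close>
lemma ex_radius_poisson_le:
  assumes w: "norm w = 1" and b: "b < 1"
  shows "\<exists>t. b \<le> t \<and> 0 \<le> t \<and> t < 1 \<and> poisson j (of_real t * w) \<le> poisson j w + 1"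
proof -
  have "1 - of_real (dilation j) * w \<noteq> 0"
    using norm_dilation_less_1[of w j] w by auto
  then have "((\<lambda>t. poisson j (of_real t * w)) \<longlongrightarrow> poisson j w) (at_left 1)"
    unfolding poisson_def herglotz_def by (auto intro!: tendsto_eq_intros)
  then have "\<forall>\<^sub>F t in at_left 1. poisson j (of_real t * w) < poisson j w + 1"
    by (rule order_tendstoD) simp
  moreover have "\<forall>\<^sub>F t in at_left 1. t \<in> {max b 0<..<1::real}"
    using b by (intro eventually_at_left_real) simp
  ultimately have "\<forall>\<^sub>F t in at_left (1::real). b \<le> t \<and> 0 \<le> t \<and> t < 1 \<and> poisson j (of_real t * w) \<le> poisson j w + 1"
    by eventually_elim auto
  then show ?thesis
    by (rule eventually_happens'[rotated]) simp
qed

text \<open>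
  With the first \<open>k\<close> radii so close to 1 that each kernel exceeds its boundary value by at most 1, and all
  other coordinates equal to 0, the sum of the weighted kernels stays below a finite bound that does
  not depend on \<open>k\<close>.
\<close>
lemma ex_approach_bounded_below:
  assumes w: "\<forall>n. norm (w n) = 1" and sum: "summable (\<lambda>j. weight j * poisson j (w j))"
  shows "\<exists>r. radial_approach r \<and>
    (\<exists>\<delta>>0. \<forall>k. \<delta> \<le> norm (point_eval infinite_product (approach_point r w k)))"
proof -
  have "\<exists>t. ramp k \<le> t \<and> 0 \<le> t \<and> t < 1 \<and> poisson n (of_real t * w n) \<le> poisson n (w n) + 1" for n k
    using w ramp_bounds by (intro ex_radius_poisson_le) auto
  then obtain t where "\<And>n k. ramp k \<le> t n k \<and> 0 \<le> t n k \<and> t n k < 1 \<and>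
      poisson n (of_real (t n k) * w n) \<le> poisson n (w n) + 1"
    by meson
  then have t: "\<And>n k. ramp k \<le> t n k" "\<And>n k. 0 \<le> t n k" "\<And>n k. t n k < 1"
      "\<And>n k. poisson n (of_real (t n k) * w n) \<le> poisson n (w n) + 1"
    by blast+
  define r where "r n k = (if n < k then t n k else 0)" for n k
  have bounds: "0 \<le> r n k" "r n k < 1" for n k
    using t by (auto simp: r_def)
  have "radial_approach r"
    unfolding radial_approach_def
  proof (intro conjI allI bounds)
    fix k
    have "\<forall>\<^sub>F n in sequentially. r n k = 0"
      using eventually_ge_at_top[of k] by eventually_elim (simp add: r_def)
    then show "(\<lambda>n. r n k) \<longlonglongrightarrow> 0" by (rule tendsto_eventually)
  next
    fix n
    show "(\<lambda>k. r n k) \<longlonglongrightarrow> 1"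
    proof (rule tendsto_sandwich[OF _ _ ramp_tendsto tendsto_const])
      show "\<forall>\<^sub>F k in sequentially. ramp k \<le> r n k"
        using eventually_gt_at_top[of n] by eventually_elim (simp add: r_def t)
      show "\<forall>\<^sub>F k in sequentially. r n k \<le> 1"
        using bounds by (intro always_eventually allI less_imp_le)
    qed
  qed
  moreover define B where "B = (\<Sum>n. weight n * (poisson n (w n) + 1))"
  have sumB: "summable (\<lambda>n. weight n * (poisson n (w n) + 1))"
    using summable_add[OF sum summable_weight] by (simp add: algebra_simps)
  have "exp (- B) \<le> norm (point_eval infinite_product (approach_point r w k))" for k
  proof -
    have z: "approach_point r w k \<in> polydisc_c0"
      unfolding approach_point_def
      by (rule in_polydisc_c0[where N = k, OF w]) (auto simp: r_def t)
    have "(\<Sum>n. weight n * poisson n (approach_point r w k n)) \<le> B"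
      unfolding B_def
    proof (intro suminf_le mult_left_mono summable_poisson[OF z] sumB)
      fix n
      show "poisson n (approach_point r w k n) \<le> poisson n (w n) + 1"
        using t(4)[of n k] poisson_nonneg[of "w n" n] w
        by (simp add: approach_point_def r_def poisson_0)
      show "0 \<le> weight n" using weight_pos[of n] by simp
    qed
    then show ?thesis unfolding norm_point_eval[OF z] by simp
  qed
  ultimately show ?thesis using exp_gt_zero[of "- B"] by blast
qed

text \<open>
  There are countably many pairs of a block and a choice of levels for its variables, and only finitely
  many for each block. An enumeration of these pairs therefore runs through every choice, while the
  block tends to infinity along it, so that each single radius tends to 1. A boundary point
  selects the subsequence \<open>\<kappa>\<close> of its own bad choices.
\<close>
lemma ex_universal_approach:
  "\<exists>r. radial_approach r \<and>
    (\<forall>w. (\<forall>n. norm (w n) = 1) \<longrightarrow> (\<lambda>m. exp (- block_minorant m w)) \<longlonglongrightarrow> 0 \<longrightarrow>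
      (\<exists>\<kappa>. filterlim \<kappa> sequentially sequentially \<and>
        (\<lambda>m. point_eval infinite_product (approach_point r w (\<kappa> m))) \<longlonglongrightarrow> 0))"
proof -
  define C where "C m = (\<Pi>\<^sub>E n\<in>block m. {..depth n})" for m
  define D where "D = (SIGMA m:UNIV. C m)"
  have finC: "finite (C m)" for m
    unfolding C_def by (intro finite_PiE finite_block) simp
  have "C m \<noteq> {}" for m
    unfolding C_def by (simp add: PiE_eq_empty_iff)
  then have "fst ` D = UNIV"
    unfolding D_def by force
  then have infD: "infinite D"
    by (metis finite_imageI infinite_UNIV_nat)
  have "countable D"
    unfolding D_def by (intro countable_SIGMA) (auto intro: countable_finite finC)
  then have bij: "bij_betw (from_nat_into D) UNIV D"
    using infD by (rule bij_betw_from_nat_into)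
  define e where "e = from_nat_into D"
  have e: "inj e" "range e = D"
    using bij by (auto simp: e_def bij_betw_def)
  have ec: "snd (e k) n \<le> depth n" if "n \<in> block (fst (e k))" for k n
  proof -
    have "e k \<in> D" using e(2) by blast
    then show ?thesis using that by (auto simp: D_def C_def PiE_iff)
  qed
  \<comment> \<open>injectivity of the enumeration: each block is visited only finitely often\<close>
  have stage_lim: "filterlim (\<lambda>k. fst (e k)) sequentially sequentially"
    unfolding filterlim_at_top
  proof
    fix M
    have "{k. fst (e k) < M} \<subseteq> e -` (SIGMA m:{..<M}. C m)"
    proof
      fix k assume "k \<in> {k. fst (e k) < M}"
      moreover have "e k \<in> D" using e(2) by blast
      ultimately show "k \<in> e -` (SIGMA m:{..<M}. C m)"
        by (cases "e k") (simp add: D_def)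
    qed
    moreover have "finite (e -` (SIGMA m:{..<M}. C m))"
      by (intro finite_vimageI e(1) finite_SigmaI finC) simp
    ultimately have "finite {k. fst (e k) < M}" by (rule finite_subset)
    then show "\<forall>\<^sub>F k in sequentially. M \<le> fst (e k)"
      by (simp add: eventually_cofinite cofinite_eq_sequentially[symmetric] not_le)
  qed
  define r where "r n k = staged_radii (fst (e k)) (\<lambda>_. ramp (fst (e k)))
    (\<lambda>n. level_radius n (snd (e k) n)) n" for n k
  have level: "0 \<le> level_radius n (snd (e k) n)" "level_radius n (snd (e k) n) < 1"
    if "n \<in> block (fst (e k))" for n k
    using level_radius_bounds[OF ec[OF that]] .
  have bounds: "0 \<le> r n k" "r n k < 1" for n k
    using ramp_bounds level[of n k] in_block_of[of n] by (auto simp: r_def staged_radii_def)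
  have "radial_approach r"
    unfolding radial_approach_def
  proof (intro conjI allI bounds)
    fix k
    have "\<forall>\<^sub>F n in sequentially. r n k = 0"
      using eventually_ge_at_top[of "block_start (Suc (fst (e k)))"]
      by eventually_elim (simp add: r_def staged_radii_vanish)
    then show "(\<lambda>n. r n k) \<longlonglongrightarrow> 0" by (rule tendsto_eventually)
  next
    fix n
    have "(\<lambda>k. ramp (fst (e k))) \<longlonglongrightarrow> 1"
      by (rule filterlim_compose[OF ramp_tendsto stage_lim])
    moreover have "\<forall>\<^sub>F k in sequentially. block_of n < fst (e k)"
      by (rule eventually_compose_filterlim[OF eventually_gt_at_top stage_lim])
    then have "\<forall>\<^sub>F k in sequentially. ramp (fst (e k)) = r n k"
      by eventually_elim (simp add: r_def staged_radii_def)
    ultimately show "(\<lambda>k. r n k) \<longlonglongrightarrow> 1"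
      by (rule Lim_transform_eventually)
  qed
  moreover have "\<exists>\<kappa>. filterlim \<kappa> sequentially sequentially \<and>
        (\<lambda>m. point_eval infinite_product (approach_point r w (\<kappa> m))) \<longlonglongrightarrow> 0"
    if w: "\<forall>n. norm (w n) = 1" and lim: "(\<lambda>m. exp (- block_minorant m w)) \<longlonglongrightarrow> 0" for w
  proof -
    have "\<exists>i\<le>depth j. dyadic_minorant (depth j) (w j) \<le> poisson j (of_real (level_radius j i) * w j)" for j
      using w by (intro ex_level_radius) simp
    then obtain c where c: "\<And>j. c j \<le> depth j"
      "\<And>j. dyadic_minorant (depth j) (w j) \<le> poisson j (of_real (level_radius j (c j)) * w j)"
      by metis
    have "(m, restrict c (block m)) \<in> range e" for m
      unfolding e(2) using c(1) by (simp add: D_def C_def)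
    then have "\<exists>k. e k = (m, restrict c (block m))" for m
      by (metis imageE)
    then obtain \<kappa> where \<kappa>: "\<And>m. e (\<kappa> m) = (m, restrict c (block m))" by metis
    then have "inj \<kappa>" by (metis injI prod.inject)
    have "filterlim \<kappa> sequentially sequentially"
      unfolding filterlim_at_top
    proof
      fix M
      have "{m. \<kappa> m < M} = \<kappa> -` {..<M}" by auto
      then have "finite {m. \<kappa> m < M}"
        using \<open>inj \<kappa>\<close> by (simp add: finite_vimageI)
      then show "\<forall>\<^sub>F m in sequentially. M \<le> \<kappa> m"
        by (simp add: eventually_cofinite cofinite_eq_sequentially[symmetric] not_le)
    qed
    moreover have "(\<lambda>m. norm (point_eval infinite_product (approach_point r w (\<kappa> m)))) \<longlonglongrightarrow> 0"
    proof (rule tendsto_sandwich[OF _ _ tendsto_const lim])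
      have "norm (point_eval infinite_product (approach_point r w (\<kappa> m))) \<le> exp (- block_minorant m w)" for m
        unfolding approach_point_def r_def \<kappa> fst_conv snd_conv
        using ramp_bounds c(2) level_radius_bounds[OF c(1)]
        by (intro norm_point_eval_staged_le w) auto
      then show "\<forall>\<^sub>F m in sequentially. norm (point_eval infinite_product (approach_point r w (\<kappa> m))) \<le> exp (- block_minorant m w)"
        by (intro always_eventually allI)
    qed simp
    ultimately show ?thesis by (metis tendsto_norm_zero_iff)
  qed
  ultimately show ?thesis by blast
qed

section \<open>Failure of radial limits\<close>

theorem theorem4:
  "\<exists>f :: (nat \<Rightarrow> complex) \<Rightarrow> complex.
     f \<in> Hinf_torus \<and>
     (\<forall>z \<in> polydisc_c0. point_eval f z \<noteq> 0) \<and>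
     (AE w in torus. \<not> has_unrestricted_radial_limit f w) \<and>
     (AE w in torus. \<exists>r. radial_approach r \<and> (\<forall>n. mono (r n)) \<and>
        \<not> (\<lambda>k. point_eval f (approach_point r w k)) \<longlonglongrightarrow> f w \<and>
        (\<lambda>k. norm (point_eval f (approach_point r w k))) \<longlonglongrightarrow> 0) \<and>
     (\<exists>r. radial_approach r \<and>
        (AE w in torus. \<not> (\<lambda>k. point_eval f (approach_point r w k)) \<longlonglongrightarrow> f w))"
proof (intro exI[of _ infinite_product] conjI)
  show "infinite_product \<in> Hinf_torus" by (rule infinite_product_Hinf)
  show "\<forall>z\<in>polydisc_c0. point_eval infinite_product z \<noteq> 0"
    using norm_point_eval by (metis exp_not_eq_zero norm_zero)
  show "AE w in torus. \<not> has_unrestricted_radial_limit infinite_product w"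
    using AE_torus_unimodular AE_exp_block_minorant_tendsto_0 AE_poisson_summable
  proof eventually_elim
    fix w :: "nat \<Rightarrow> complex"
    assume w: "\<forall>n. norm (w n) = 1" and lim: "(\<lambda>m. exp (- block_minorant m w)) \<longlonglongrightarrow> 0"
      and sum: "summable (\<lambda>j. weight j * poisson j (w j))"
    obtain r where r: "radial_approach r"
      "(\<lambda>k. norm (point_eval infinite_product (approach_point r w k))) \<longlonglongrightarrow> 0"
      using ex_increasing_approach_to_0[OF w lim] by blast
    obtain r' \<delta> where r': "radial_approach r'" "\<delta> > 0"
      "\<And>k. \<delta> \<le> norm (point_eval infinite_product (approach_point r' w k))"
      using ex_approach_bounded_below[OF w sum] by blast
    show "\<not> has_unrestricted_radial_limit infinite_product w"
    proof
      assume "has_unrestricted_radial_limit infinite_product w"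
      then obtain L where "\<forall>r. radial_approach r \<longrightarrow>
          (\<lambda>k. point_eval infinite_product (approach_point r w k)) \<longlonglongrightarrow> L"
        unfolding has_unrestricted_radial_limit_def by (rule exE)
      then have L: "(\<lambda>k. norm (point_eval infinite_product (approach_point r w k))) \<longlonglongrightarrow> norm L"
        if "radial_approach r" for r
        using that by (intro tendsto_norm) simp
      have "norm L = 0" using LIMSEQ_unique[OF L[OF r(1)] r(2)] .
      moreover have "\<delta> \<le> norm L"
        using r'(3) by (intro tendsto_lowerbound[OF L[OF r'(1)]]) auto
      ultimately show False using \<open>\<delta> > 0\<close> by simp
    qed
  qed
  show "AE w in torus. \<exists>r. radial_approach r \<and> (\<forall>n. mono (r n)) \<and>
      \<not> (\<lambda>k. point_eval infinite_product (approach_point r w k)) \<longlonglongrightarrow> infinite_product w \<and>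
      (\<lambda>k. norm (point_eval infinite_product (approach_point r w k))) \<longlonglongrightarrow> 0"
    using AE_torus_unimodular AE_exp_block_minorant_tendsto_0 AE_infinite_product_nonzero
  proof eventually_elim
    fix w :: "nat \<Rightarrow> complex"
    assume w: "\<forall>n. norm (w n) = 1" and lim: "(\<lambda>m. exp (- block_minorant m w)) \<longlonglongrightarrow> 0"
      and nz: "infinite_product w \<noteq> 0"
    obtain r where r: "radial_approach r" "\<forall>n. mono (r n)"
      "(\<lambda>k. norm (point_eval infinite_product (approach_point r w k))) \<longlonglongrightarrow> 0"
      using ex_increasing_approach_to_0[OF w lim] by blast
    moreover have "\<not> (\<lambda>k. point_eval infinite_product (approach_point r w k)) \<longlonglongrightarrow> infinite_product w"
      using r(3) nz by (metis LIMSEQ_unique tendsto_norm_zero_iff)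
    ultimately show "\<exists>r. radial_approach r \<and> (\<forall>n. mono (r n)) \<and>
      \<not> (\<lambda>k. point_eval infinite_product (approach_point r w k)) \<longlonglongrightarrow> infinite_product w \<and>
      (\<lambda>k. norm (point_eval infinite_product (approach_point r w k))) \<longlonglongrightarrow> 0"
      by blast
  qed
  obtain r where r: "radial_approach r"
    and sub: "\<And>w. \<forall>n. norm (w n) = 1 \<Longrightarrow> (\<lambda>m. exp (- block_minorant m w)) \<longlonglongrightarrow> 0 \<Longrightarrow>
      \<exists>\<kappa>. filterlim \<kappa> sequentially sequentially \<and>
        (\<lambda>m. point_eval infinite_product (approach_point r w (\<kappa> m))) \<longlonglongrightarrow> 0"
    using ex_universal_approach by blast
  have "AE w in torus. \<not> (\<lambda>k. point_eval infinite_product (approach_point r w k)) \<longlonglongrightarrow> infinite_product w"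
    using AE_torus_unimodular AE_exp_block_minorant_tendsto_0 AE_infinite_product_nonzero
  proof eventually_elim
    fix w :: "nat \<Rightarrow> complex"
    assume w: "\<forall>n. norm (w n) = 1" and lim: "(\<lambda>m. exp (- block_minorant m w)) \<longlonglongrightarrow> 0"
      and nz: "infinite_product w \<noteq> 0"
    obtain \<kappa> where \<kappa>: "filterlim \<kappa> sequentially sequentially"
      "(\<lambda>m. point_eval infinite_product (approach_point r w (\<kappa> m))) \<longlonglongrightarrow> 0"
      using sub[OF w lim] by blast
    show "\<not> (\<lambda>k. point_eval infinite_product (approach_point r w k)) \<longlonglongrightarrow> infinite_product w"
      using LIMSEQ_unique[OF filterlim_compose[OF _ \<kappa>(1)] \<kappa>(2)] nz by blast
  qed
  with r show "\<exists>r. radial_approach r \<and> (AE w in torus.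
      \<not> (\<lambda>k. point_eval infinite_product (approach_point r w k)) \<longlonglongrightarrow> infinite_product w)"
    by blast
qed

end
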